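(* Fix $\varepsilon\in(0,\varepsilon_{\max})$, write $\Omega=\Omega_\varepsilon$, let $f$ satisfy the regularity condition stated in the context, and let $v\in\mathbb R$. Let $B$ be the standard candidate on $\Omega_L(v,+\infty)$. Then for every point $x\in\Omega_L(v,+\infty)$ there exists a sequence of non-increasing test functions $\varphi_{n,x}$ which is an optimizing sequence for $B$ at $x$; moreover $g(v)\preceq\varphi_{n,x}$ pointwise. (The decay condition $(1+|w_L-g|)\exp(\int_{t_0}^t\lambda_L)\to0$ as $t\to+\infty$ is not assumed.)
   Context: Domains. Let $0<\varepsilon_{\max}\le\infty$ and let $\mathbf g(\cdot;\varepsilon)=(\mathbf g_1,\mathbf g_2):\mathbb R\to\mathbb R^2$, $0\le\varepsilon<\varepsilon_{\max}$, be $C^3$ curves, $C^{3,1}$-smooth in $(t,\varepsilon)$ (the mixed derivative $\partial_t^3\partial_\varepsilon\mathbf g$ is continuous), such that for every $\varepsilon$ (primes denote $\partial_t$) $\mathbf g_1'>0$ and $\mathbf g_2''\mathbf g_1'-\mathbf g_2'\mathbf g_1''>0$. Put $g(t)=(g_1(t),g_2(t))=\mathbf g(t;0)$ and $\Xi_\varepsilon=\{(\mathbf g_1(t;\varepsilon),x_2):t\in\mathbb R,\ x_2>\mathbf g_2(t;\varepsilon)\}$. Assume that for $\varepsilon_1<\varepsilon_2$ one has $\Xi_{\varepsilon_1}\supset\Xi_{\varepsilon_2}$ and $\mathbf g(t;\varepsilon_1)\notin\overline{\Xi_{\varepsilon_2}}$ for all $t$. Assume that for every $\varepsilon\in(0,\varepsilon_{\max})$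 and $t\in\mathbb R$ there are two tangent lines from $g(t)$ to $\Xi_\varepsilon$, each meeting the curve $g(\cdot)$ twice. Let $w_L(t;\varepsilon)=\mathbf g(s_L;\varepsilon)$ and $w_R(t;\varepsilon)=\mathbf g(s_R;\varepsilon)$, $s_R<s_L$, be the tangency points, $S_L(t;\varepsilon)=[g(t),w_L(t;\varepsilon)]$, $S_R(t;\varepsilon)=[g(t),w_R(t;\varepsilon)]$ the tangent segments, and $\kappa_L,\kappa_R$ their slopes; assume $\partial_\varepsilon\kappa_L\ne0$, $\partial_\varepsilon\kappa_R\neq 0$ everywhere. Let $T_\varepsilon(t)$ be the closed curvilinear triangle with vertex $g(t)$ bounded by $S_L(t;\varepsilon)$, $S_R(t;\varepsilon)$ and the arc of $\mathbf g(\cdot;\varepsilon)$ between the two tangency points, and $\Omega_\varepsilon=\bigcup_{t}T_\varepsilon(t)$. The fixed boundary is $\partial_{\rm fixed}\Omega_\varepsilon=g(\mathbb R)$. The scalar function $\lambda_L<0$ is defined by $\lambda_L(t)(g(t)-w_L(t))=w_L'(t)$. Put $\kappa_2=g_2'/g_1'$, $\kappa_3=f'/g_1'$, $\mathfrak K=\kappa_3'/\kappa_2'$. Regularity condition on $f:\mathbb R\to\mathbb R$: $f\in C^2(\mathbb R)$ and $\mathfrak K$ is piecewise monotone with finitely many monotonicity intervals. Standard candidate on $\Omega_L(v,+\infty)=\bigcup_{t>v}S_L(t)$: with $\kappa=\kappa_L$ (so $\kappa_2-\kappa<0$), it is $B(x)=f(t)+(x_1-g_1(t))[\kappa_3(t)+(\kappa(t)-\kappa_2(t))\beta_2(t)]$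 for $x\in S_L(t)$, where $\beta_2(t)=\mathfrak K(t)+\int_t^{+\infty}\exp\big(\int_t^\tau\frac{\kappa_2'}{\kappa_2-\kappa}\big)d\mathfrak K(\tau)$ is required to be finite and to satisfy $\beta_2'(t)=-\frac{\kappa_2'(t)}{\kappa_2(t)-\kappa(t)}\int_t^{+\infty}\exp\big(\int_t^\tau\frac{\kappa_2'}{\kappa_2-\kappa}\big)d\mathfrak K(\tau)>0$ for $t>v$. For an interval $I$, $\mathbf A_\Omega(I)$ is the class of summable $\varphi:I\to\partial_{\rm fixed}\Omega$ with average $\langle\varphi\rangle_J\in\Omega$ for every subinterval $J\subset I$. A test function for $x$ is $\varphi\in\mathbf A_\Omega(I)$ with $\langle\varphi\rangle_I=x$. With $\mathrm f(g(t))=f(t)$, an optimizing sequence for $B$ at $x$ is a sequence of test functions $\varphi_n$ for $x$ with $B(x)=\lim_n\langle \mathrm f(\varphi_n)\rangle_I$. On $\partial_{\rm fixed}\Omega$ one writes $g(t)\preceq g(s)$ if $t\le s$; monotonicity of $\varphi$ is with respect to $\preceq$. *)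

theory Defs
  imports "HOL-Analysis.Analysis"
begin

section \<open>Stieltjes integrals\<close>

text \<open>Riemann--Stieltjes integral of \<open>h\<close> with respect to \<open>F\<close> over \<open>{a..b}\<close>: limit of the tagged
  sums as the mesh tends to zero.\<close>

definition has_stieltjes_integral ::
  "(real \<Rightarrow> real) \<Rightarrow> (real \<Rightarrow> real) \<Rightarrow> real \<Rightarrow> real \<Rightarrow> real \<Rightarrow> bool" where
  "has_stieltjes_integral h F a b y \<longleftrightarrow>
     (\<forall>e>0. \<exists>d>0. \<forall>p. p tagged_division_of {a..b} \<and> (\<lambda>x. ball x d) fine p \<longrightarrow>
        \<bar>(\<Sum>(x, k)\<in>p. h x * (F (Sup k) - F (Inf k))) - y\<bar> < e)"

definition has_stieltjes_integral_at_top ::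
  "(real \<Rightarrow> real) \<Rightarrow> (real \<Rightarrow> real) \<Rightarrow> real \<Rightarrow> real \<Rightarrow> bool" where
  "has_stieltjes_integral_at_top h F a y \<longleftrightarrow>
     (\<exists>Y. (\<forall>b\<ge>a. has_stieltjes_integral h F a b (Y b)) \<and> (Y \<longlongrightarrow> y) at_top)"

definition stieltjes_integral_at_top :: "(real \<Rightarrow> real) \<Rightarrow> (real \<Rightarrow> real) \<Rightarrow> real \<Rightarrow> real" where
  "stieltjes_integral_at_top h F a = (THE y. has_stieltjes_integral_at_top h F a y)"


section \<open>Families of convex curves\<close>

text \<open>A family of curves is a function \<open>G\<close>, where \<open>G \<epsilon> t\<close> is the point with parameter \<open>t\<close> on the
  curve with index \<open>\<epsilon>\<close>; the curve \<open>G 0\<close> will be the fixed boundary.\<close>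

type_synonym plane = "real \<times> real"
type_synonym family = "real \<Rightarrow> real \<Rightarrow> plane"

definition g1 :: "family \<Rightarrow> real \<Rightarrow> real \<Rightarrow> real" where
  "g1 G \<epsilon> t = fst (G \<epsilon> t)"

definition g2 :: "family \<Rightarrow> real \<Rightarrow> real \<Rightarrow> real" where
  "g2 G \<epsilon> t = snd (G \<epsilon> t)"

definition index_range :: "ereal \<Rightarrow> real set" where
  "index_range \<epsilon>max = {\<epsilon>. 0 \<le> \<epsilon> \<and> ereal \<epsilon> < \<epsilon>max}"

text \<open>\<open>D i j\<close> is the derivative of order \<open>i\<close> in \<open>t\<close> and of order \<open>j\<close> in \<open>\<epsilon>\<close>; at the endpoint
  \<open>\<epsilon> = 0\<close> the \<open>\<epsilon>\<close>-derivative is one-sided.\<close>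

definition C31_smooth :: "real set \<Rightarrow> (real \<Rightarrow> real \<Rightarrow> real) \<Rightarrow> bool" where
  "C31_smooth E h \<longleftrightarrow>
     (\<exists>D :: nat \<Rightarrow> nat \<Rightarrow> real \<Rightarrow> real \<Rightarrow> real.
        (\<forall>\<epsilon>\<in>E. \<forall>t. D 0 0 \<epsilon> t = h \<epsilon> t) \<and>
        (\<forall>i<3. \<forall>j\<le>1. \<forall>\<epsilon>\<in>E. \<forall>t. (D i j \<epsilon> has_real_derivative D (Suc i) j \<epsilon> t) (at t)) \<and>
        (\<forall>i\<le>3. \<forall>\<epsilon>\<in>E. \<forall>t. ((\<lambda>e. D i 0 e t) has_real_derivative D i 1 \<epsilon> t) (at \<epsilon> within E)) \<and>
        (\<forall>i\<le>3. \<forall>j\<le>1. continuous_on (E \<times> UNIV) (\<lambda>(\<epsilon>, t). D i j \<epsilon> t)))"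

definition Xi :: "family \<Rightarrow> real \<Rightarrow> plane set" where
  "Xi G \<epsilon> = {(g1 G \<epsilon> t, x2) | t x2. x2 > g2 G \<epsilon> t}"

definition tangent_line :: "(real \<Rightarrow> plane) \<Rightarrow> real \<Rightarrow> plane set" where
  "tangent_line \<gamma> s = {\<gamma> s + c *\<^sub>R vector_derivative \<gamma> (at s) | c. True}"

text \<open>Parameters of the points at which the lines through \<open>G 0 t\<close> are tangent to the convex set
  \<open>Xi G \<epsilon>\<close>. By strict convexity of the curve, different parameters belong to different lines.\<close>

definition tangency_params :: "family \<Rightarrow> real \<Rightarrow> real \<Rightarrow> real set" where
  "tangency_params G \<epsilon> t = {s. G 0 t \<in> tangent_line (G \<epsilon>) s}"

definition s_L :: "family \<Rightarrow> real \<Rightarrow> real \<Rightarrow> real" where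
  "s_L G \<epsilon> t = Max (tangency_params G \<epsilon> t)"

definition s_R :: "family \<Rightarrow> real \<Rightarrow> real \<Rightarrow> real" where
  "s_R G \<epsilon> t = Min (tangency_params G \<epsilon> t)"

definition w_L :: "family \<Rightarrow> real \<Rightarrow> real \<Rightarrow> plane" where
  "w_L G \<epsilon> t = G \<epsilon> (s_L G \<epsilon> t)"

definition w_R :: "family \<Rightarrow> real \<Rightarrow> real \<Rightarrow> plane" where
  "w_R G \<epsilon> t = G \<epsilon> (s_R G \<epsilon> t)"

definition S_L :: "family \<Rightarrow> real \<Rightarrow> real \<Rightarrow> plane set" where
  "S_L G \<epsilon> t = closed_segment (G 0 t) (w_L G \<epsilon> t)"

definition S_R :: "family \<Rightarrow> real \<Rightarrow> real \<Rightarrow> plane set" where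
  "S_R G \<epsilon> t = closed_segment (G 0 t) (w_R G \<epsilon> t)"

definition slope :: "plane \<Rightarrow> plane \<Rightarrow> real" where
  "slope p q = (snd q - snd p) / (fst q - fst p)"

definition kappa_L :: "family \<Rightarrow> real \<Rightarrow> real \<Rightarrow> real" where
  "kappa_L G \<epsilon> t = slope (G 0 t) (w_L G \<epsilon> t)"

definition kappa_R :: "family \<Rightarrow> real \<Rightarrow> real \<Rightarrow> real" where
  "kappa_R G \<epsilon> t = slope (G 0 t) (w_R G \<epsilon> t)"

definition admissible_family :: "ereal \<Rightarrow> family \<Rightarrow> bool" where
  "admissible_family \<epsilon>max G \<longleftrightarrow>
     0 < \<epsilon>max \<and>
     C31_smooth (index_range \<epsilon>max) (g1 G) \<and>
     C31_smooth (index_range \<epsilon>max) (g2 G) \<and>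
     (\<forall>\<epsilon>\<in>index_range \<epsilon>max. \<forall>t.
        deriv (g1 G \<epsilon>) t > 0 \<and>
        deriv (deriv (g2 G \<epsilon>)) t * deriv (g1 G \<epsilon>) t
          - deriv (g2 G \<epsilon>) t * deriv (deriv (g1 G \<epsilon>)) t > 0) \<and>
     (\<forall>\<epsilon>1\<in>index_range \<epsilon>max. \<forall>\<epsilon>2\<in>index_range \<epsilon>max. \<epsilon>1 < \<epsilon>2 \<longrightarrow>
        Xi G \<epsilon>2 \<subseteq> Xi G \<epsilon>1 \<and> (\<forall>t. G \<epsilon>1 t \<notin> closure (Xi G \<epsilon>2))) \<and>
     (\<forall>\<epsilon>\<in>index_range \<epsilon>max - {0}. \<forall>t.
        card (tangency_params G \<epsilon> t) = 2 \<and>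
        (\<forall>s\<in>tangency_params G \<epsilon> t. card (tangent_line (G \<epsilon>) s \<inter> range (G 0)) = 2) \<and>
        (\<exists>d. d \<noteq> 0 \<and> ((\<lambda>e. kappa_L G e t) has_real_derivative d) (at \<epsilon>)) \<and>
        (\<exists>d. d \<noteq> 0 \<and> ((\<lambda>e. kappa_R G e t) has_real_derivative d) (at \<epsilon>)))"


section \<open>The domain\<close>

definition triangle_sides :: "family \<Rightarrow> real \<Rightarrow> real \<Rightarrow> plane set" where
  "triangle_sides G \<epsilon> t = S_L G \<epsilon> t \<union> S_R G \<epsilon> t \<union> G \<epsilon> ` {s_R G \<epsilon> t..s_L G \<epsilon> t}"

text \<open>The sides form a closed curve; \<open>inside\<close> is the union of the bounded components of its
  complement.\<close>

definition curvilinear_triangle :: "family \<Rightarrow> real \<Rightarrow> real \<Rightarrow> plane set" where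
  "curvilinear_triangle G \<epsilon> t = triangle_sides G \<epsilon> t \<union> inside (triangle_sides G \<epsilon> t)"

definition Omega :: "family \<Rightarrow> real \<Rightarrow> plane set" where
  "Omega G \<epsilon> = (\<Union>t. curvilinear_triangle G \<epsilon> t)"

definition fixed_boundary :: "family \<Rightarrow> plane set" where
  "fixed_boundary G = range (G 0)"

definition Omega_L :: "family \<Rightarrow> real \<Rightarrow> real \<Rightarrow> plane set" where
  "Omega_L G \<epsilon> v = (\<Union>t\<in>{v<..}. S_L G \<epsilon> t)"

definition boundary_le :: "family \<Rightarrow> plane \<Rightarrow> plane \<Rightarrow> bool" where
  "boundary_le G y z \<longleftrightarrow> (\<exists>t s. y = G 0 t \<and> z = G 0 s \<and> t \<le> s)"

text \<open>The transfer of \<open>f\<close> to the fixed boundary; \<open>G 0\<close> is injective for admissible families,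
  since its first coordinate is strictly increasing.\<close>

definition boundary_fun :: "family \<Rightarrow> (real \<Rightarrow> real) \<Rightarrow> plane \<Rightarrow> real" where
  "boundary_fun G f y = f (inv (G 0) y)"


section \<open>The standard candidate\<close>

definition kappa2 :: "family \<Rightarrow> real \<Rightarrow> real" where
  "kappa2 G t = deriv (g2 G 0) t / deriv (g1 G 0) t"

definition kappa3 :: "family \<Rightarrow> (real \<Rightarrow> real) \<Rightarrow> real \<Rightarrow> real" where
  "kappa3 G f t = deriv f t / deriv (g1 G 0) t"

definition K_ratio :: "family \<Rightarrow> (real \<Rightarrow> real) \<Rightarrow> real \<Rightarrow> real" where
  "K_ratio G f t = deriv (kappa3 G f) t / deriv (kappa2 G) t"

definition piecewise_monotone :: "(real \<Rightarrow> real) \<Rightarrow> bool" where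
  "piecewise_monotone h \<longleftrightarrow>
     (\<exists>P. finite P \<and>
        (\<forall>J. is_interval J \<and> J \<inter> P = {} \<longrightarrow> mono_on J h \<or> antimono_on J h))"

definition regular_fun :: "family \<Rightarrow> (real \<Rightarrow> real) \<Rightarrow> bool" where
  "regular_fun G f \<longleftrightarrow>
     (\<forall>t. f differentiable (at t)) \<and> (\<forall>t. deriv f differentiable (at t)) \<and>
     continuous_on UNIV (deriv (deriv f)) \<and>
     piecewise_monotone (K_ratio G f)"

definition exp_weight :: "family \<Rightarrow> real \<Rightarrow> real \<Rightarrow> real \<Rightarrow> real" where
  "exp_weight G \<epsilon> t \<tau> =
     exp (integral {t..\<tau>} (\<lambda>u. deriv (kappa2 G) u / (kappa2 G u - kappa_L G \<epsilon> u)))"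

definition beta_tail :: "family \<Rightarrow> real \<Rightarrow> (real \<Rightarrow> real) \<Rightarrow> real \<Rightarrow> real" where
  "beta_tail G \<epsilon> f t = stieltjes_integral_at_top (exp_weight G \<epsilon> t) (K_ratio G f) t"

definition beta2 :: "family \<Rightarrow> real \<Rightarrow> (real \<Rightarrow> real) \<Rightarrow> real \<Rightarrow> real" where
  "beta2 G \<epsilon> f t = K_ratio G f t + beta_tail G \<epsilon> f t"

definition beta2' :: "family \<Rightarrow> real \<Rightarrow> (real \<Rightarrow> real) \<Rightarrow> real \<Rightarrow> real" where
  "beta2' G \<epsilon> f t =
     - (deriv (kappa2 G) t / (kappa2 G t - kappa_L G \<epsilon> t)) * beta_tail G \<epsilon> f t"

text \<open>The segments \<open>S_L G \<epsilon> t\<close> are pairwise disjoint for admissible families, so the formula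
  determines \<open>B\<close> on \<open>Omega_L G \<epsilon> v\<close>; nothing is required of \<open>B\<close> elsewhere.\<close>

definition standard_candidate ::
  "family \<Rightarrow> real \<Rightarrow> (real \<Rightarrow> real) \<Rightarrow> real \<Rightarrow> (plane \<Rightarrow> real) \<Rightarrow> bool" where
  "standard_candidate G \<epsilon> f v B \<longleftrightarrow>
     (\<forall>t>v.
        (\<exists>y. has_stieltjes_integral_at_top (exp_weight G \<epsilon> t) (K_ratio G f) t y) \<and>
        (beta2 G \<epsilon> f has_real_derivative beta2' G \<epsilon> f t) (at t) \<and>
        beta2' G \<epsilon> f t > 0 \<and>
        (\<forall>x\<in>S_L G \<epsilon> t.
           B x = f t + (fst x - g1 G 0 t) *
                   (kappa3 G f t + (kappa_L G \<epsilon> t - kappa2 G t) * beta2 G \<epsilon> f t)))"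


section \<open>Test functions and optimizing sequences\<close>

definition proper_interval :: "real set \<Rightarrow> bool" where
  "proper_interval I \<longleftrightarrow> is_interval I \<and> bounded I \<and> interior I \<noteq> {}"

definition average :: "(real \<Rightarrow> 'a::euclidean_space) \<Rightarrow> real set \<Rightarrow> 'a" where
  "average \<phi> J = (1 / measure lebesgue J) *\<^sub>R (LINT s:J|lebesgue. \<phi> s)"

definition A_class :: "plane set \<Rightarrow> plane set \<Rightarrow> real set \<Rightarrow> (real \<Rightarrow> plane) set" where
  "A_class \<Omega> \<Gamma> I =
     {\<phi>. set_integrable lebesgue I \<phi> \<and> \<phi> ` I \<subseteq> \<Gamma> \<and>
         (\<forall>J. proper_interval J \<and> J \<subseteq> I \<longrightarrow> average \<phi> J \<in> \<Omega>)}"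

definition test_function ::
  "plane set \<Rightarrow> plane set \<Rightarrow> real set \<Rightarrow> plane \<Rightarrow> (real \<Rightarrow> plane) \<Rightarrow> bool" where
  "test_function \<Omega> \<Gamma> I x \<phi> \<longleftrightarrow> \<phi> \<in> A_class \<Omega> \<Gamma> I \<and> average \<phi> I = x"

text \<open>Integrability of \<open>F \<circ> \<phi> n\<close> is required, because the Bochner integral of a non-integrable
  function is \<open>0\<close> by convention.\<close>

definition optimizing_sequence ::
  "plane set \<Rightarrow> plane set \<Rightarrow> (plane \<Rightarrow> real) \<Rightarrow> real set \<Rightarrow> (plane \<Rightarrow> real) \<Rightarrow> plane
     \<Rightarrow> (nat \<Rightarrow> real \<Rightarrow> plane) \<Rightarrow> bool" where
  "optimizing_sequence \<Omega> \<Gamma> F I B x \<phi> \<longleftrightarrow>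
     (\<forall>n. test_function \<Omega> \<Gamma> I x (\<phi> n)) \<and>
     (\<forall>n. set_integrable lebesgue I (F \<circ> \<phi> n)) \<and>
     (\<lambda>n. average (F \<circ> \<phi> n) I) \<longlonglongrightarrow> B x"

definition nonincreasing_on :: "family \<Rightarrow> real set \<Rightarrow> (real \<Rightarrow> plane) \<Rightarrow> bool" where
  "nonincreasing_on G I \<phi> \<longleftrightarrow> monotone_on I (\<le>) (\<lambda>y z. boundary_le G z y) \<phi>"

end

theory Submission
  imports Defs
begin

text \<open>
  Write \<open>g\<close> for the lower curve \<open>G 0\<close>, \<open>\<gamma>\<close> for the upper curve \<open>G \<epsilon>\<close>, and \<open>w t\<close> for the point where
  the left tangent from \<open>g t\<close> touches \<open>\<gamma>\<close>. The optimal test function for the point \<open>w t\<close> would be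
  the delivery curve: a non-increasing function with values in \<open>g\<close> on \<open>{t..}\<close> whose averages over
  initial intervals run along \<open>\<gamma>\<close>, from the far right to \<open>w t\<close>. But \<open>w\<close> may
  grow as fast as the remaining mass decays, and then the full curve misses the average \<open>w t\<close>.
  Therefore it is cut off at a parameter \<open>T > t\<close>, and \<open>T\<close> tends to infinity along the sequence.

  The tangent at \<open>w T\<close> meets \<open>g\<close> at \<open>T\<close> and at a further parameter \<open>U > T\<close>, so \<open>w T\<close> is a convex
  combination of \<open>g U\<close> and \<open>g T\<close>. The truncated function takes the value \<open>g U\<close>, then \<open>g T\<close>, in the
  proportion that has the average \<open>w T\<close>, then follows the delivery curve down to \<open>t\<close>, and finally
  stays at \<open>g t\<close> for as long as the position of the given point on the tangent segment requires.

  It is a test function by a single-crossing argument. At every moment \<open>d\<close> the average over the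
  past lies on the left tangent from the current value \<open>g (\<tau> d)\<close>. Points of \<open>g\<close> on \<open>{\<tau> d..}\<close>
  are below this tangent up to its second intersection with \<open>g\<close> and above it afterwards. Since
  \<open>\<tau>\<close> is non-increasing, the function is first above the tangent and then below it, with total
  signed distance zero; so over every final piece of the past the average is below the tangent,
  and hence below \<open>\<gamma>\<close> (\<open>average_below_tangent\<close>). It is above \<open>g\<close> by convexity, and every point
  between the two curves lies on some left tangent segment (\<open>covered_by_tangent\<close>).

  The values \<open>B (w t)\<close> satisfy the same linear differential equation with right-hand side \<open>f\<close>
  that the contact points satisfy with right-hand side \<open>g\<close>. So the only error of the truncated
  function is the one committed at \<open>w T\<close>, where \<open>B\<close> is replaced by the chord value of \<open>f\<close> between
  \<open>T\<close> and \<open>U\<close>, multiplied by the proportion of the interval on which the function is \<open>g U\<close> or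
  \<open>g T\<close>. Let \<open>K = \<kappa>\<^sub>3' / \<kappa>\<^sub>2'\<close>. Comparing derivatives along \<open>g\<close> shows that \<open>\<beta>\<^sub>2\<close> at \<open>T\<close>
  bounds the mean of \<open>K\<close> hidden in the chord value from above, and monotonicity of \<open>K\<close> near infinity bounds it below by
  the value of \<open>K\<close> at \<open>T\<close> (\<open>chord_defect\<close>). After multiplication by the proportion the error is
  at most a constant times the part beyond \<open>T\<close> of the convergent Stieltjes integral defining
  \<open>\<beta>\<^sub>2\<close> at \<open>t\<close> (\<open>stieltjes_tail_tendsto_0\<close>), and this tends to zero.\<close>

section \<open>Strictly convex curves\<close>

text \<open>The curve is parametrised by \<open>(x, y)\<close> and \<open>k\<close> is its slope, so that curvature becomes the single
  condition that \<open>k\<close> increases.\<close>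

locale convex_curve =
  fixes x y x' k k' :: "real \<Rightarrow> real"
  assumes x_deriv: "\<And>t. (x has_real_derivative x' t) (at t)"
    and x'_pos: "\<And>t. x' t > 0"
    and y_deriv: "\<And>t. (y has_real_derivative k t * x' t) (at t)"
    and k_deriv: "\<And>t. (k has_real_derivative k' t) (at t)"
    and k'_pos: "\<And>t. k' t > 0"
begin

definition tangent_at :: "real \<Rightarrow> real \<Rightarrow> real" where
  "tangent_at s X = y s + k s * (X - x s)"

lemma x_strict_mono: "a < b \<Longrightarrow> x a < x b"
  using DERIV_pos_imp_increasing[of a b x] x_deriv x'_pos by blast

lemma x_less_iff: "x a < x b \<longleftrightarrow> a < b"
  using x_strict_mono by (metis less_asym linorder_neqE_linordered_idom)

lemma x_le_iff: "x a \<le> x b \<longleftrightarrow> a \<le> b"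
  using x_less_iff by (meson not_le)

lemma x_eq_iff: "x a = x b \<longleftrightarrow> a = b"
  using x_less_iff by (metis less_irrefl linorder_neqE_linordered_idom)

lemma k_strict_mono: "a < b \<Longrightarrow> k a < k b"
  using DERIV_pos_imp_increasing[of a b k] k_deriv k'_pos by blast

lemma continuous_x: "continuous_on A x"
  by (meson DERIV_isCont continuous_at_imp_continuous_on x_deriv)

lemma continuous_y: "continuous_on A y"
  by (meson DERIV_isCont continuous_at_imp_continuous_on y_deriv)

lemma continuous_k: "continuous_on A k"
  by (meson DERIV_isCont continuous_at_imp_continuous_on k_deriv)

text \<open>Along the curve, the distance to a line of slope \<open>k s\<close> decreases before \<open>s\<close> and increases after it.\<close>

lemma tangent_below:
  assumes "r \<noteq> s"
  shows "tangent_at s (x r) < y r"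
proof -
  define h where "h = (\<lambda>t. y t - k s * x t)"
  have h': "(h has_real_derivative (k t - k s) * x' t) (at t)" for t
    unfolding h_def
    by (rule derivative_eq_intros x_deriv y_deriv refl)+ (simp add: algebra_simps)
  have "h s < h r"
  proof (cases "s < r")
    case True
    show ?thesis
      by (rule DERIV_pos_imp_increasing_open[OF True])
        (use h' x'_pos k_strict_mono in \<open>auto intro!: exI mult_pos_pos
          DERIV_isCont continuous_at_imp_continuous_on\<close>)
  next
    case False
    then have "r < s" using assms by simp
    then show ?thesis
      by (rule DERIV_neg_imp_decreasing_open)
        (use h' x'_pos k_strict_mono in \<open>auto intro!: exI mult_neg_pos
          DERIV_isCont continuous_at_imp_continuous_on\<close>)
  qed
  then show ?thesis by (simp add: h_def tangent_at_def algebra_simps)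
qed

lemma tangent_le: "tangent_at s (x r) \<le> y r"
  using tangent_below[of r s] by (cases "r = s") (auto simp: tangent_at_def)

text \<open>As a tangent rolls along the curve, its height over a fixed abscissa rises until the point of
  contact passes this abscissa and falls afterwards. This unimodality identifies the two tangents
  through an exterior point.\<close>

lemma tangent_increasing:
  assumes "r < s" and "x s \<le> X"
  shows "tangent_at r X < tangent_at s X"
proof -
  have "tangent_at r X = tangent_at r (x s) + k r * (X - x s)"
    by (simp add: tangent_at_def algebra_simps)
  also have "\<dots> < y s + k s * (X - x s)"
    using tangent_below[of s r] mult_right_mono[of "k r" "k s" "X - x s"]
      k_strict_mono[of r s] assms by auto
  finally show ?thesis by (simp add: tangent_at_def)
qed

lemma tangent_decreasing:
  assumes "r < s" and "X \<le> x r"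
  shows "tangent_at s X < tangent_at r X"
proof -
  have "tangent_at s X = tangent_at s (x r) + k s * (X - x r)"
    by (simp add: tangent_at_def algebra_simps)
  also have "\<dots> < y r + k r * (X - x r)"
    using tangent_below[of r s] mult_right_mono_neg[of "k r" "k s" "X - x r"]
      k_strict_mono[of r s] assms by auto
  finally show ?thesis by (simp add: tangent_at_def)
qed

text \<open>Away from the middle point, on the side where the line falls at least as fast as the tangent there,
  the curve gains on the line, because it stays above that tangent.\<close>

lemma line_minus_curve_quasiconcave:
  assumes "a < b" and "b < c"
  shows "min (m * x a + q - y a) (m * x c + q - y c) < m * x b + q - y b"
proof (cases "k b \<le> m")
  case True
  have "y b + k b * (x a - x b) < y a"
    using tangent_below[of a b] assms by (simp add: tangent_at_def)
  moreover have "(m - k b) * (x a - x b) \<le> 0"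
    using True x_strict_mono[OF assms(1)] by (simp add: mult_nonneg_nonpos)
  ultimately show ?thesis by (simp add: algebra_simps)
next
  case False
  have "y b + k b * (x c - x b) < y c"
    using tangent_below[of c b] assms by (simp add: tangent_at_def)
  moreover have "(m - k b) * (x c - x b) \<le> 0"
    using False x_strict_mono[OF assms(2)] by (simp add: mult_nonpos_nonneg)
  ultimately show ?thesis by (simp add: algebra_simps)
qed

end

section \<open>Tangents from the lower to the upper curve\<close>

text \<open>The parameters \<open>s\<^sub>R t\<close> and \<open>s\<^sub>L t\<close> are those of the two points of the upper curve whose tangents
  pass through the point \<open>t\<close> of the lower curve.\<close>

locale curve_pair =
  lower: convex_curve x y x' \<kappa>\<^sub>2 \<kappa>\<^sub>2' + upper: convex_curve X Y X' \<mu> \<mu>'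
  for x y x' \<kappa>\<^sub>2 \<kappa>\<^sub>2' X Y X' \<mu> \<mu>' :: "real \<Rightarrow> real" +
  fixes s\<^sub>R s\<^sub>L :: "real \<Rightarrow> real"
  assumes upper_above: "\<And>s. \<exists>t. x t = X s \<and> y t < Y s"
    and s\<^sub>R_less_s\<^sub>L: "\<And>t. s\<^sub>R t < s\<^sub>L t"
    and tangency_iff: "\<And>t s. upper.tangent_at s (x t) = y t \<longleftrightarrow> s = s\<^sub>R t \<or> s = s\<^sub>L t"
    and second_intersection:
      "\<And>t s. upper.tangent_at s (x t) = y t \<Longrightarrow> \<exists>u. u \<noteq> t \<and> upper.tangent_at s (x u) = y u"
    and continuous_\<kappa>\<^sub>2': "continuous_on UNIV \<kappa>\<^sub>2'"
begin

definition height :: "real \<Rightarrow> real \<Rightarrow> real" where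
  "height s t = upper.tangent_at s (x t) - y t"

lemma height_quasiconcave:
  assumes "a < b" and "b < c"
  shows "min (height s a) (height s c) < height s b"
proof -
  have "height s t = \<mu> s * x t + (Y s - \<mu> s * X s) - y t" for t
    by (simp add: height_def upper.tangent_at_def algebra_simps)
  then show ?thesis using lower.line_minus_curve_quasiconcave[OF assms] by simp
qed

lemma height_zero_iff: "height s t = 0 \<longleftrightarrow> s = s\<^sub>R t \<or> s = s\<^sub>L t"
  using tangency_iff by (simp add: height_def)

lemma height_s\<^sub>L [simp]: "height (s\<^sub>L t) t = 0" and height_s\<^sub>R [simp]: "height (s\<^sub>R t) t = 0"
  by (auto simp: height_zero_iff)

lemma obtain_below:
  obtains t where "x t = X s" and "height s t > 0"
proof -
  obtain t where "x t = X s" "y t < Y s" using upper_above by blast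
  then show ?thesis using that[of t] by (simp add: height_def upper.tangent_at_def)
qed

lemma X_s\<^sub>L: "x t < X (s\<^sub>L t)" and X_s\<^sub>R: "X (s\<^sub>R t) < x t"
proof -
  have eq: "upper.tangent_at (s\<^sub>R t) (x t) = upper.tangent_at (s\<^sub>L t) (x t)"
    using tangency_iff[of "s\<^sub>R t" t] tangency_iff[of "s\<^sub>L t" t] by simp
  show "x t < X (s\<^sub>L t)"
    using upper.tangent_increasing[OF s\<^sub>R_less_s\<^sub>L, of t "x t"] eq by force
  show "X (s\<^sub>R t) < x t"
    using upper.tangent_decreasing[OF s\<^sub>R_less_s\<^sub>L, of "x t" t] eq by force
qed

lemma s\<^sub>L_eqI: "height s t = 0 \<Longrightarrow> x t \<le> X s \<Longrightarrow> s = s\<^sub>L t"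
  using X_s\<^sub>R[of t] height_zero_iff[of s t] by auto

text \<open>The contact point is above the lower curve and to the right of \<open>t\<close>. By quasiconcavity of the
  height, a second zero to the left of \<open>t\<close>, or between \<open>t\<close> and the contact, is impossible.\<close>

lemma obtain_right_intersection:
  obtains u where "t < u" and "height (s\<^sub>L t) u = 0"
proof -
  obtain w where w: "x w = X (s\<^sub>L t)" "height (s\<^sub>L t) w > 0" by (rule obtain_below)
  have tw: "t < w" using X_s\<^sub>L[of t] w(1) lower.x_less_iff by metis
  obtain u where u: "u \<noteq> t" "height (s\<^sub>L t) u = 0"
    using second_intersection[of "s\<^sub>L t" t] tangency_iff[of "s\<^sub>L t" t] by (auto simp: height_def)
  have "\<not> u < t" using height_quasiconcave[of u t w "s\<^sub>L t"] w(2) u tw by auto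
  then show ?thesis using that u by force
qed

lemma obtain_left_intersection:
  obtains u where "x u \<le> X (s\<^sub>R t)" and "height (s\<^sub>R t) u = 0"
proof -
  obtain w where w: "x w = X (s\<^sub>R t)" "height (s\<^sub>R t) w > 0" by (rule obtain_below)
  have tw: "w < t" using X_s\<^sub>R[of t] w(1) lower.x_less_iff by metis
  obtain u where u: "u \<noteq> t" "height (s\<^sub>R t) u = 0"
    using second_intersection[of "s\<^sub>R t" t] tangency_iff[of "s\<^sub>R t" t] by (auto simp: height_def)
  have "\<not> w < u"
    using height_quasiconcave[of w u t "s\<^sub>R t"] height_quasiconcave[of w t u "s\<^sub>R t"] w(2) u tw
    by (cases u t rule: linorder_cases) auto
  then have "x u \<le> X (s\<^sub>R t)" using w(1) lower.x_le_iff by (metis not_le)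
  then show ?thesis using that u by force
qed

lemma slope_less: "\<kappa>\<^sub>2 t < \<mu> (s\<^sub>L t)"
proof -
  obtain u where u: "t < u" "height (s\<^sub>L t) u = 0" by (rule obtain_right_intersection)
  have "y t + \<kappa>\<^sub>2 t * (x u - x t) < y u"
    using lower.tangent_below[of u t] u by (simp add: lower.tangent_at_def)
  moreover have "y u - y t = \<mu> (s\<^sub>L t) * (x u - x t)"
    using u(2) height_s\<^sub>L[of t] by (simp add: height_def upper.tangent_at_def algebra_simps)
  ultimately have "\<kappa>\<^sub>2 t * (x u - x t) < \<mu> (s\<^sub>L t) * (x u - x t)" by simp
  then show ?thesis using lower.x_strict_mono[OF u(1)] by simp
qed

lemma height_pos_left_of_contact:
  assumes "t < u" and "x u \<le> X (s\<^sub>L t)"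
  shows "0 < height (s\<^sub>L t) u"
proof -
  obtain w where w: "x w = X (s\<^sub>L t)" "height (s\<^sub>L t) w > 0" by (rule obtain_below)
  have "u \<le> w" using assms w(1) lower.x_le_iff by metis
  then show ?thesis
    using height_quasiconcave[of t u w "s\<^sub>L t"] assms w(2) by (cases "u = w") auto
qed

text \<open>If the contact did not move to the right, then the earlier tangent, being at least as steep, would
  not be above the later source point; but between its source and its contact a left tangent is
  strictly above the lower curve.\<close>

lemma s\<^sub>L_strict_mono: "strict_mono s\<^sub>L"
proof (rule strict_monoI, rule ccontr)
  fix t u :: real assume tu: "t < u" and "\<not> s\<^sub>L t < s\<^sub>L u"
  then have le: "s\<^sub>L u \<le> s\<^sub>L t" by simp
  then have xu: "x u \<le> X (s\<^sub>L t)" using X_s\<^sub>L[of u] upper.x_le_iff by (meson less_imp_le order_trans)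
  have "upper.tangent_at (s\<^sub>L t) (x u) \<le> upper.tangent_at (s\<^sub>L u) (x u)"
    using upper.tangent_decreasing[of "s\<^sub>L u" "s\<^sub>L t" "x u"] X_s\<^sub>L[of u] le
    by (cases "s\<^sub>L u = s\<^sub>L t") auto
  then have "height (s\<^sub>L t) u \<le> 0" using height_s\<^sub>L[of u] by (simp add: height_def)
  then show False using height_pos_left_of_contact[OF tu xu] by simp
qed

text \<open>The right tangent from \<open>r\<close> meets the lower curve a second time, to the left of its contact. There the
  tangent at \<open>s\<close>, whose contact is further right, is not above the lower curve, while at its own
  contact it is; the point where it emerges is the source.\<close>

lemma obtain_source:
  assumes "s\<^sub>R r \<le> s"
  obtains t where "s\<^sub>L t = s"
proof -
  obtain u where u: "x u \<le> X (s\<^sub>R r)" "height (s\<^sub>R r) u = 0" by (rule obtain_left_intersection)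
  obtain w where w: "x w = X s" "height s w > 0" by (rule obtain_below)
  have uw: "u \<le> w" using u(1) w(1) assms upper.x_le_iff lower.x_le_iff by (metis order_trans)
  have "upper.tangent_at s (x u) \<le> upper.tangent_at (s\<^sub>R r) (x u)"
    using upper.tangent_decreasing[of "s\<^sub>R r" s "x u"] u(1) assms by (cases "s\<^sub>R r = s") auto
  then have "height s u \<le> 0" using u(2) by (simp add: height_def)
  moreover have "continuous_on {u..w} (height s)"
    unfolding height_def upper.tangent_at_def
    by (intro continuous_intros lower.continuous_x lower.continuous_y)
  ultimately obtain t where t: "u \<le> t" "t \<le> w" "height s t = 0"
    using IVT'[of "height s" u 0 w] w(2) uw by auto
  then have "x t \<le> X s" using w(1) lower.x_le_iff by metis
  then show ?thesis using s\<^sub>L_eqI[OF t(3)] that by auto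
qed

text \<open>A monotone function with open range has no jumps.\<close>

lemma continuous_s\<^sub>L: "continuous_on UNIV s\<^sub>L"
proof (rule continuous_onI_mono)
  show "open (range s\<^sub>L)"
  proof (subst open_subopen, safe)
    fix t
    have "{s\<^sub>R t<..} \<subseteq> range s\<^sub>L"
      using obtain_source[of t] by (metis greaterThan_iff less_imp_le rangeI subsetI)
    then show "\<exists>T. open T \<and> s\<^sub>L t \<in> T \<and> T \<subseteq> range s\<^sub>L"
      using s\<^sub>R_less_s\<^sub>L[of t] by (intro exI[of _ "{s\<^sub>R t<..}"]) auto
  qed
qed (simp add: s\<^sub>L_strict_mono strict_mono_less_eq)

text \<open>Over the abscissa \<open>p\<close> the tangents of the upper curve sweep all heights between the two curves, as
  the contact moves from above \<open>p\<close> to the contact of the left tangent from the point of the lower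
  curve below \<open>p\<close>. This is how the averages of a test function are recognised as points of the
  domain.\<close>

lemma covered_by_tangent:
  assumes "x r = p" and "y r \<le> q" and "q \<le> upper.tangent_at s0 p"
  obtains t where "x t \<le> p" and "p \<le> X (s\<^sub>L t)" and "upper.tangent_at (s\<^sub>L t) p = q"
proof -
  have "\<exists>s. s\<^sub>R r \<le> s \<and> s \<le> s\<^sub>L r \<and> X s = p"
    by (rule IVT') (use X_s\<^sub>R[of r] X_s\<^sub>L[of r] s\<^sub>R_less_s\<^sub>L[of r] assms(1) upper.continuous_x in auto)
  then obtain s where s: "s\<^sub>R r \<le> s" "s \<le> s\<^sub>L r" "X s = p" by blast
  have cont: "continuous_on {s..s\<^sub>L r} (\<lambda>s. upper.tangent_at s p)"
    unfolding upper.tangent_at_def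
    by (intro continuous_intros upper.continuous_x upper.continuous_y upper.continuous_k)
  have "upper.tangent_at s0 p \<le> Y s" using upper.tangent_le[of s0 s] s(3) by simp
  then have 1: "q \<le> upper.tangent_at s p" using assms(3) s(3) by (simp add: upper.tangent_at_def)
  have 2: "upper.tangent_at (s\<^sub>L r) p \<le> q"
    using height_s\<^sub>L[of r] assms by (simp add: height_def)
  obtain s' where s': "s \<le> s'" "s' \<le> s\<^sub>L r" "upper.tangent_at s' p = q"
    using IVT2'[of "\<lambda>s. upper.tangent_at s p", OF 2 1 s(2) cont] by blast
  obtain t where t: "s\<^sub>L t = s'" using obtain_source[of r s'] s(1) s'(1) by auto
  have p: "p \<le> X (s\<^sub>L t)" using s(3) s'(1) t upper.x_le_iff by metis
  \<comment> \<open>Otherwise the tangent would be on or above the lower curve at \<open>r\<close>, meet it at \<open>t\<close>, and be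
    strictly above it at the contact, against quasiconcavity.\<close>
  have "\<not> r < t"
  proof
    assume "r < t"
    obtain w where w: "x w = X (s\<^sub>L t)" "height (s\<^sub>L t) w > 0" by (rule obtain_below)
    have "t < w" using X_s\<^sub>L[of t] w(1) lower.x_less_iff by metis
    moreover have "height (s\<^sub>L t) r \<ge> 0" using assms(1,2) s'(3) t by (simp add: height_def)
    ultimately show False using height_quasiconcave[of r t w "s\<^sub>L t"] \<open>r < t\<close> w(2) by auto
  qed
  then have "x t \<le> p" using assms(1) lower.x_le_iff by (metis not_le)
  then show ?thesis using that p s'(3) t by blast
qed

definition right_intersection :: "real \<Rightarrow> real" where
  "right_intersection t = (SOME u. t < u \<and> height (s\<^sub>L t) u = 0)"

lemma right_intersection:
  "t < right_intersection t" "height (s\<^sub>L t) (right_intersection t) = 0"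
proof -
  have "\<exists>u. t < u \<and> height (s\<^sub>L t) u = 0" using obtain_right_intersection by blast
  from someI_ex[OF this]
  show "t < right_intersection t" "height (s\<^sub>L t) (right_intersection t) = 0"
    by (auto simp: right_intersection_def)
qed

lemma height_nonneg:
  assumes "t \<le> r" and "r \<le> right_intersection t"
  shows "0 \<le> height (s\<^sub>L t) r"
  using height_quasiconcave[of t r "right_intersection t" "s\<^sub>L t"] right_intersection[of t] assms
  by (cases "r = t"; cases "r = right_intersection t") auto

lemma height_nonpos:
  assumes "right_intersection t \<le> r"
  shows "height (s\<^sub>L t) r \<le> 0"
  using height_quasiconcave[of t "right_intersection t" r "s\<^sub>L t"] right_intersection[of t] assms
  by (cases "r = right_intersection t") auto

text \<open>The second intersection \<open>U\<close> of the tangent from \<open>t\<close> is not above any later tangent whose source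
  has not passed \<open>U\<close>: either their contact is beyond \<open>U\<close>, or they have rolled upwards over the abscissa
  of \<open>U\<close>.\<close>

lemma right_intersection_height_nonneg:
  assumes "t \<le> r" and "r \<le> right_intersection t"
  shows "0 \<le> height (s\<^sub>L r) (right_intersection t)"
proof -
  define u where "u = right_intersection t"
  have u: "t < u" "height (s\<^sub>L t) u = 0" using right_intersection[of t] by (auto simp: u_def)
  consider "r = t" | "r = u" | "t < r" "r < u" "X (s\<^sub>L r) \<le> x u"
    | "r < u" "x u \<le> X (s\<^sub>L r)" using assms by (force simp: u_def)
  then have "0 \<le> height (s\<^sub>L r) u"
  proof cases
    case 3
    then have "upper.tangent_at (s\<^sub>L t) (x u) < upper.tangent_at (s\<^sub>L r) (x u)"
      using upper.tangent_increasing strict_monoD[OF s\<^sub>L_strict_mono] by blast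
    then show ?thesis using u(2) by (simp add: height_def)
  next
    case 4
    then show ?thesis using height_pos_left_of_contact by (simp add: less_imp_le)
  qed (use u(2) in simp_all)
  then show ?thesis by (simp add: u_def)
qed

definition width :: "real \<Rightarrow> real" where "width t = X (s\<^sub>L t) - x t"
definition \<kappa> :: "real \<Rightarrow> real" where "\<kappa> t = \<mu> (s\<^sub>L t)"

lemma width_pos: "0 < width t"
  using X_s\<^sub>L by (simp add: width_def)

lemma \<kappa>_greater: "\<kappa>\<^sub>2 t < \<kappa> t"
  using slope_less by (simp add: \<kappa>_def)

lemma Y_s\<^sub>L: "Y (s\<^sub>L t) = y t + \<kappa> t * width t"
  using height_s\<^sub>L[of t]
  by (simp add: height_def upper.tangent_at_def \<kappa>_def width_def algebra_simps)

lemma height_s\<^sub>L_eq: "height (s\<^sub>L t) r = y t + \<kappa> t * (x r - x t) - y r"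
  using height_s\<^sub>L[of t]
  by (simp add: height_def upper.tangent_at_def \<kappa>_def algebra_simps)

text \<open>Implicit differentiation of the tangency condition. Splitting the increment into one at a fixed
  abscissa and one along the tangent needs only differentiability of the tangent height in the
  parameter of contact, together with continuity of \<open>s\<^sub>L\<close>.\<close>

lemma s\<^sub>L_deriv:
  "(s\<^sub>L has_real_derivative x' t * (\<kappa> t - \<kappa>\<^sub>2 t) / (\<mu>' (s\<^sub>L t) * width t)) (at t)"
proof -
  define m where "m = \<mu>' (s\<^sub>L t) * (x t - X (s\<^sub>L t))"
  have "m \<noteq> 0" using upper.k'_pos[of "s\<^sub>L t"] X_s\<^sub>L[of t] by (simp add: m_def)
  have "((\<lambda>s. upper.tangent_at s (x t)) has_real_derivative m) (at (s\<^sub>L t))"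
    unfolding upper.tangent_at_def m_def
    by (rule derivative_eq_intros upper.x_deriv upper.y_deriv upper.k_deriv refl)+ 
      (simp add: algebra_simps)
  then obtain q where q: "\<And>s. upper.tangent_at s (x t) - upper.tangent_at (s\<^sub>L t) (x t)
      = q s * (s - s\<^sub>L t)" "isCont q (s\<^sub>L t)" "q (s\<^sub>L t) = m"
    unfolding CARAT_DERIV by blast
  have cont: "isCont s\<^sub>L t" 
    using continuous_s\<^sub>L continuous_on_eq_continuous_at[of UNIV s\<^sub>L] by simp
  have key: "q (s\<^sub>L u) * (s\<^sub>L u - s\<^sub>L t) = (y u - y t) - \<mu> (s\<^sub>L u) * (x u - x t)" for u
    using q(1)[of "s\<^sub>L u"] height_s\<^sub>L[of u] height_s\<^sub>L[of t]
    by (simp add: height_def upper.tangent_at_def algebra_simps)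
  have q1: "((\<lambda>u. q (s\<^sub>L u)) \<longlongrightarrow> m) (at t)"
    using isCont_o2[OF cont q(2)] q(3) by (simp add: isCont_def)
  have q2: "((\<lambda>u. \<mu> (s\<^sub>L u)) \<longlongrightarrow> \<kappa> t) (at t)"
    using isCont_o2[OF cont DERIV_isCont[OF upper.k_deriv]] by (simp add: isCont_def \<kappa>_def)
  have dx: "((\<lambda>u. (x u - x t) / (u - t)) \<longlongrightarrow> x' t) (at t)"
    using lower.x_deriv[of t] by (simp add: has_field_derivative_iff)
  have dy: "((\<lambda>u. (y u - y t) / (u - t)) \<longlongrightarrow> \<kappa>\<^sub>2 t * x' t) (at t)"
    using lower.y_deriv[of t] by (simp add: has_field_derivative_iff)
  have lim: "((\<lambda>u. ((y u - y t) / (u - t) - \<mu> (s\<^sub>L u) * ((x u - x t) / (u - t))) / q (s\<^sub>L u))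
      \<longlongrightarrow> (\<kappa>\<^sub>2 t * x' t - \<kappa> t * x' t) / m) (at t)"
    by (intro tendsto_intros dx dy q1 q2 \<open>m \<noteq> 0\<close>)
  have "\<forall>\<^sub>F u in at t. q (s\<^sub>L u) \<noteq> 0"
    using q1 \<open>m \<noteq> 0\<close> by (rule tendsto_imp_eventually_ne)
  then have "\<forall>\<^sub>F u in at t. 
      ((y u - y t) / (u - t) - \<mu> (s\<^sub>L u) * ((x u - x t) / (u - t))) / q (s\<^sub>L u)
      = (s\<^sub>L u - s\<^sub>L t) / (u - t)"
  proof eventually_elim
    case (elim u)
    have "(y u - y t) / (u - t) - \<mu> (s\<^sub>L u) * ((x u - x t) / (u - t))
      = q (s\<^sub>L u) * (s\<^sub>L u - s\<^sub>L t) / (u - t)"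
      unfolding key by (simp only: diff_divide_distrib [of "y u - y t"] times_divide_eq_right)
    then show ?case using elim by simp
  qed
  from Lim_transform_eventually[OF lim this]
  have "((\<lambda>u. (s\<^sub>L u - s\<^sub>L t) / (u - t)) \<longlongrightarrow> (\<kappa>\<^sub>2 t * x' t - \<kappa> t * x' t) / m) (at t)"
    .
  moreover have "(\<kappa>\<^sub>2 t * x' t - \<kappa> t * x' t) / m = x' t * (\<kappa> t - \<kappa>\<^sub>2 t) / (\<mu>' (s\<^sub>L t) * width t)"
  proof -
    have "m = - (\<mu>' (s\<^sub>L t) * width t)" by (simp add: m_def width_def algebra_simps)
    then show ?thesis by (simp add: algebra_simps minus_divide_left [symmetric] diff_divide_distrib)
  qed
  ultimately show ?thesis by (simp add: has_field_derivative_iff)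
qed

definition X\<^sub>L' :: "real \<Rightarrow> real" where
  "X\<^sub>L' t = X' (s\<^sub>L t) * (x' t * (\<kappa> t - \<kappa>\<^sub>2 t) / (\<mu>' (s\<^sub>L t) * width t))"

lemma X\<^sub>L'_pos: "0 < X\<^sub>L' t"
  using upper.x'_pos lower.x'_pos \<kappa>_greater upper.k'_pos width_pos by (simp add: X\<^sub>L'_def)

lemma X\<^sub>L_deriv: "((\<lambda>t. X (s\<^sub>L t)) has_real_derivative X\<^sub>L' t) (at t)"
  unfolding X\<^sub>L'_def by (rule DERIV_chain2[OF upper.x_deriv s\<^sub>L_deriv])

lemma Y\<^sub>L_deriv: "((\<lambda>t. Y (s\<^sub>L t)) has_real_derivative \<kappa> t * X\<^sub>L' t) (at t)"
  using DERIV_chain2[OF upper.y_deriv s\<^sub>L_deriv, of t]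
  by (simp only: X\<^sub>L'_def \<kappa>_def mult.assoc)

lemma \<kappa>_deriv: "(\<kappa> has_real_derivative x' t * (\<kappa> t - \<kappa>\<^sub>2 t) / width t) (at t)"
proof -
  have "\<kappa> = (\<lambda>t. \<mu> (s\<^sub>L t))" by (simp add: fun_eq_iff \<kappa>_def)
  then show ?thesis
    using DERIV_chain2[OF upper.k_deriv s\<^sub>L_deriv, of t] upper.k'_pos[of "s\<^sub>L t"] by simp
qed

lemma width_deriv: "(width has_real_derivative X\<^sub>L' t - x' t) (at t)"
proof -
  have "width = (\<lambda>t. X (s\<^sub>L t) - x t)" by (simp add: fun_eq_iff width_def)
  then show ?thesis using DERIV_diff[OF X\<^sub>L_deriv lower.x_deriv] by simp
qed

end

section \<open>Averages of monotone functions\<close>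

context curve_pair
begin

definition segment_point :: "real \<Rightarrow> real \<Rightarrow> real \<Rightarrow> bool" where
  "segment_point t p q \<longleftrightarrow> x t \<le> p \<and> p \<le> X (s\<^sub>L t) \<and> upper.tangent_at (s\<^sub>L t) p = q"

lemma height_integral:
  assumes "((\<lambda>s. x (\<tau> s)) has_integral (d - c) * p) {c..d}"
    and "((\<lambda>s. y (\<tau> s)) has_integral (d - c) * q) {c..d}" and "c \<le> d"
  shows "((\<lambda>s. height r (\<tau> s)) has_integral (d - c) * (upper.tangent_at r p - q)) {c..d}"
proof -
  have "((\<lambda>s. (Y r - \<mu> r * X r) + \<mu> r * x (\<tau> s) - y (\<tau> s)) has_integral
      (d - c) * (Y r - \<mu> r * X r) + \<mu> r * ((d - c) * p) - (d - c) * q) {c..d}"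
    by (intro has_integral_diff has_integral_add has_integral_mult_right assms)
      (use has_integral_const_real[of "Y r - \<mu> r * X r" c d] assms(3) in simp)
  then show ?thesis
    by (simp add: height_def upper.tangent_at_def algebra_simps)
qed

text \<open>Let \<open>U\<close> be the second intersection of the tangent from \<open>\<tau> b\<close>. If \<open>\<tau> c \<le> U\<close>, then from \<open>c\<close> on
  the function is below the tangent. If \<open>\<tau> c > U\<close>, then up to \<open>c\<close> it is above, and the balance over
  the whole interval makes up for this after \<open>c\<close>.\<close>

lemma average_below_tangent:
  fixes a b c :: real and \<tau> :: "real \<Rightarrow> real"
  assumes anti: "antimono_on {a..b} \<tau>"
    and balance: "((\<lambda>s. height (s\<^sub>L (\<tau> b)) (\<tau> s)) has_integral 0) {a..b}"
    and sub: "((\<lambda>s. height (s\<^sub>L (\<tau> b)) (\<tau> s)) has_integral i) {c..b}"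
    and "a \<le> c" "c \<le> b"
  shows "0 \<le> i"
proof (cases "\<tau> c \<le> right_intersection (\<tau> b)")
  case True
  have "0 \<le> height (s\<^sub>L (\<tau> b)) (\<tau> s)" if "s \<in> {c..b}" for s
  proof (rule height_nonneg)
    show "\<tau> b \<le> \<tau> s" by (rule monotone_onD[OF anti]; use that assms(4,5) in auto)
    have "\<tau> s \<le> \<tau> c" by (rule monotone_onD[OF anti]; use that assms(4,5) in auto)
    then show "\<tau> s \<le> right_intersection (\<tau> b)" using True by simp
  qed
  then show ?thesis using has_integral_nonneg[OF sub] by blast
next
  case False
  have sub': "(\<lambda>s. height (s\<^sub>L (\<tau> b)) (\<tau> s)) integrable_on {a..c}"
    using has_integral_integrable[OF balance] by (rule integrable_subinterval_real) (use assms in auto)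
  have "height (s\<^sub>L (\<tau> b)) (\<tau> s) \<le> 0" if "s \<in> {a..c}" for s
  proof (rule height_nonpos)
    have "\<tau> c \<le> \<tau> s" by (rule monotone_onD[OF anti]; use that assms(4,5) in auto)
    then show "right_intersection (\<tau> b) \<le> \<tau> s" using False by simp
  qed
  then have "integral {a..c} (\<lambda>s. height (s\<^sub>L (\<tau> b)) (\<tau> s)) \<le> 0"
    using has_integral_le[OF integrable_integral[OF sub'] has_integral_0] by blast
  moreover have "integral {a..c} (\<lambda>s. height (s\<^sub>L (\<tau> b)) (\<tau> s)) + i = 0"
    using has_integral_unique[OF has_integral_combine[OF assms(4,5) integrable_integral[OF sub'] sub] balance] .
  ultimately show ?thesis by simp
qed

lemma average_in_some_segment:
  fixes a b c :: real and \<tau> :: "real \<Rightarrow> real"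
  assumes anti: "antimono_on {a..b} \<tau>"
    and balance: "((\<lambda>s. height (s\<^sub>L (\<tau> b)) (\<tau> s)) has_integral 0) {a..b}"
    and "a \<le> c" "c < b"
    and p: "((\<lambda>s. x (\<tau> s)) has_integral (b - c) * p) {c..b}"
    and q: "((\<lambda>s. y (\<tau> s)) has_integral (b - c) * q) {c..b}"
  shows "\<exists>t. segment_point t p q"
proof -
  have bounds: "\<tau> b \<le> \<tau> s" "\<tau> s \<le> \<tau> c" if "s \<in> {c..b}" for s
    by ((rule monotone_onD[OF anti]; use that assms(3,4) in auto)+)
  have const: "((\<lambda>s. m) has_integral (b - c) * m) {c..b}" for m :: real
    using has_integral_const_real[of m c b] assms(4) by simp
  have "(b - c) * x (\<tau> b) \<le> (b - c) * p" "(b - c) * p \<le> (b - c) * x (\<tau> c)"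
    using bounds lower.x_le_iff
    by (auto intro!: has_integral_le[OF const p] has_integral_le[OF p const])
  then have "x (\<tau> b) \<le> p" "p \<le> x (\<tau> c)" using assms(4) by simp_all
  moreover have "\<tau> b \<le> \<tau> c" using bounds assms(4) by auto
  ultimately obtain r where r: "x r = p"
    using IVT'[of x "\<tau> b" p "\<tau> c"] lower.continuous_x by blast
  have line: "((\<lambda>s. (y r - \<kappa>\<^sub>2 r * x r) + \<kappa>\<^sub>2 r * x (\<tau> s)) has_integral
      (b - c) * (y r - \<kappa>\<^sub>2 r * x r) + \<kappa>\<^sub>2 r * ((b - c) * p)) {c..b}"
    by (intro has_integral_add has_integral_mult_right const p)
  have "(b - c) * (y r - \<kappa>\<^sub>2 r * x r) + \<kappa>\<^sub>2 r * ((b - c) * p) \<le> (b - c) * q"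
    by (rule has_integral_le[OF line q])
      (use lower.tangent_le[of r] in \<open>simp add: lower.tangent_at_def algebra_simps\<close>)
  then have "(b - c) * y r \<le> (b - c) * q" using r by (simp add: algebra_simps)
  then have yr: "y r \<le> q" using assms(4) by simp
  have "0 \<le> (b - c) * (upper.tangent_at (s\<^sub>L (\<tau> b)) p - q)"
    by (rule average_below_tangent[OF anti balance height_integral[OF p q]]) (use assms in auto)
  then have "q \<le> upper.tangent_at (s\<^sub>L (\<tau> b)) p"
    using assms(4) by (simp add: zero_le_mult_iff)
  then show ?thesis
    using covered_by_tangent[OF r yr] by (auto simp: segment_point_def)
qed

section \<open>Truncated delivery curves\<close>

text \<open>The factor of proportionality in \<open>w\<^sub>L' = rate * (g - w\<^sub>L)\<close>; it is negative because the contact point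
  moves away from its source.\<close>

definition rate :: "real \<Rightarrow> real" where "rate t = - X\<^sub>L' t / width t"

text \<open>If the mass \<open>m\<close> of the past of a delivery curve obeys \<open>m' = rate * m\<close>, this equation says that
  \<open>m * w\<close> grows by the values \<open>h\<close> that are added, so that \<open>w\<close> is their running average.\<close>

definition solves_delivery :: "real \<Rightarrow> (real \<Rightarrow> real) \<Rightarrow> (real \<Rightarrow> real) \<Rightarrow> bool" where
  "solves_delivery a0 h w \<longleftrightarrow>
     (\<forall>t>a0. (w has_real_derivative rate t * (h t - w t)) (at t))"

lemma solves_delivery_contact:
  "solves_delivery a0 x (\<lambda>t. X (s\<^sub>L t))" "solves_delivery a0 y (\<lambda>t. Y (s\<^sub>L t))"
proof -
  have "X\<^sub>L' t = rate t * (x t - X (s\<^sub>L t))" for t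
    using width_pos[of t] by (simp add: rate_def width_def field_simps)
  then show "solves_delivery a0 x (\<lambda>t. X (s\<^sub>L t))"
    using X\<^sub>L_deriv by (simp add: solves_delivery_def)
  have "\<kappa> t * X\<^sub>L' t = rate t * (y t - Y (s\<^sub>L t))" for t
    using width_pos[of t] by (simp add: rate_def Y_s\<^sub>L)
  then show "solves_delivery a0 y (\<lambda>t. Y (s\<^sub>L t))"
    using Y\<^sub>L_deriv by (simp add: solves_delivery_def)
qed

end

text \<open>The variable \<open>s\<close> of the test function starts at \<open>a\<close>, and \<open>e r - a\<close> is the length of the past at
  the moment when the value with parameter \<open>r\<close> is reached. The bound \<open>a0\<close> leaves room to the left
  of \<open>t\<close>, so that all derivatives are two-sided.\<close>

locale delivery = curve_pair +
  fixes a a0 t T :: real and e :: "real \<Rightarrow> real"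
  assumes a0: "a0 < t" "t < T"
    and e_gt: "\<And>r. a0 < r \<Longrightarrow> a < e r"
    and e_deriv: "\<And>r. a0 < r \<Longrightarrow> (e has_real_derivative rate r * (e r - a)) (at r)"
begin

definition \<sigma> :: "real \<Rightarrow> real" where "\<sigma> = the_inv_into {a0<..} e"

definition U :: real where "U = right_intersection T"

text \<open>The share of \<open>U\<close> in the convex combination of \<open>U\<close> and \<open>T\<close> that gives the contact point of \<open>T\<close>.\<close>

definition \<alpha> :: real where "\<alpha> = width T / (x U - x T)"

definition s1 :: real where "s1 = a + \<alpha> * (e T - a)"

definition \<tau> :: "real \<Rightarrow> real" where
  "\<tau> s = (if s \<le> s1 then U else if s \<le> e T then T else if s < e t then \<sigma> s else t)"

lemma e_deriv_neg: "a0 < r \<Longrightarrow> rate r * (e r - a) < 0"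
  using X\<^sub>L'_pos[of r] width_pos[of r] e_gt[of r] by (simp add: rate_def mult_pos_pos)

lemma e_decreasing: "a0 < r \<Longrightarrow> r < s \<Longrightarrow> e s < e r"
  using DERIV_neg_imp_decreasing[of r s e] e_deriv e_deriv_neg
  by (meson less_le_trans)

lemma inj_e: "inj_on e {a0<..}"
  by (rule linorder_inj_onI) (use e_decreasing in fastforce)+

lemma \<sigma>_e: "a0 < r \<Longrightarrow> \<sigma> (e r) = r"
  by (simp add: \<sigma>_def the_inv_into_f_f[OF inj_e])

lemma continuous_e: "continuous_on {a0<..} e"
  by (rule continuous_at_imp_continuous_on) (use e_deriv DERIV_isCont in auto)

lemma obtain_e:
  assumes "e T \<le> s" "s \<le> e t"
  obtains r where "t \<le> r" "r \<le> T" "e r = s" "\<sigma> s = r"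
proof -
  have "continuous_on {t..T} e" by (rule continuous_on_subset[OF continuous_e]) (use a0 in auto)
  then obtain r where "t \<le> r" "r \<le> T" "e r = s" using IVT2'[of e T s t] assms a0 by auto
  then show ?thesis using that \<sigma>_e[of r] a0 by auto
qed

lemma \<sigma>_deriv:
  assumes "a0 < r"
  shows "(\<sigma> has_real_derivative inverse (rate r * (e r - a))) (at (e r))"
proof -
  define D where "D = rate r * (e r - a)"
  have D: "D \<noteq> 0" using e_deriv_neg[OF assms] unfolding D_def by linarith
  have "(\<sigma> has_derivative (*) (inverse D)) (at (e r))"
    by (rule has_derivative_inverse_strong[OF _ _ continuous_e \<sigma>_e
          e_deriv[OF assms, unfolded has_field_derivative_def, folded D_def]])
      (use assms D in \<open>auto simp: fun_eq_iff\<close>)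
  then show ?thesis by (simp add: has_field_derivative_def D_def)
qed

text \<open>The primitive is \<open>(s - a) * w (\<sigma> s)\<close>, the past length times the running average.\<close>

lemma integral_\<sigma>:
  assumes w: "solves_delivery a0 h w" and "t \<le> r" "r \<le> T"
  shows "((\<lambda>s. h (\<sigma> s)) has_integral (e r - a) * w r - (e T - a) * w T) {e T..e r}"
proof -
  have "((\<lambda>s. h (\<sigma> s)) has_integral (e r - a) * w (\<sigma> (e r)) - (e T - a) * w (\<sigma> (e T))) {e T..e r}"
  proof (rule fundamental_theorem_of_calculus)
    show "e T \<le> e r" using e_decreasing[of r T] a0 assms by (cases "r = T") auto
    fix s assume s: "s \<in> {e T..e r}"
    have "e r \<le> e t" using e_decreasing[of t r] a0 assms by (cases "r = t") auto
    then obtain u where u: "t \<le> u" "e u = s" "\<sigma> s = u" using obtain_e[of s] s by auto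
    define D where "D = rate u * (e u - a)"
    have D: "D \<noteq> 0" "a0 < u" using e_deriv_neg[of u] u a0 by (auto simp: D_def)
    have "(w has_real_derivative rate u * (h u - w u)) (at (\<sigma> s))"
      using w D u by (simp add: solves_delivery_def)
    from this \<sigma>_deriv[OF D(2)] have
      "((\<lambda>s. w (\<sigma> s)) has_real_derivative rate u * (h u - w u) * inverse D) (at s)"
      unfolding u(2) D_def by (rule DERIV_chain2)
    from DERIV_mult[OF DERIV_diff[OF DERIV_ident DERIV_const[of a]] this] have
      "((\<lambda>s. (s - a) * w (\<sigma> s)) has_real_derivative
        w u + rate u * (h u - w u) * inverse D * (s - a)) (at s)" using u by simp
    moreover have "w u + rate u * (h u - w u) * inverse D * (s - a) = h (\<sigma> s)"
    proof -
      have "rate u * (s - a) = D" using u by (simp add: D_def)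
      then have "rate u * (s - a) * inverse D = 1" using D by simp
      then have "(rate u * (s - a) * inverse D) * (h u - w u) = h u - w u" by simp
      then show ?thesis using u by (simp add: algebra_simps)
    qed
    ultimately show "((\<lambda>s. (s - a) * w (\<sigma> s)) has_vector_derivative h (\<sigma> s)) (at s within {e T..e r})"
      by (simp add: has_real_derivative_iff_has_vector_derivative [symmetric] has_field_derivative_at_within)
  qed
  then show ?thesis using \<sigma>_e a0 assms by simp
qed

lemma U_gt: "T < U"
  by (simp add: U_def right_intersection)

lemma \<alpha>_pos: "0 < \<alpha>"
  using width_pos[of T] lower.x_strict_mono[OF U_gt] by (simp add: \<alpha>_def)

lemma U_height: "height (s\<^sub>L T) U = 0"
  by (simp add: U_def right_intersection)

lemma \<alpha>_less: "\<alpha> < 1"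
proof -
  have "\<not> x U \<le> X (s\<^sub>L T)" using height_pos_left_of_contact[OF U_gt] U_height by force
  then show ?thesis using lower.x_strict_mono[OF U_gt] by (simp add: \<alpha>_def width_def)
qed

lemma order: "a < s1" "s1 < e T" "e T < e t"
proof -
  have "a < e T" using e_gt a0 by simp
  then show "a < s1" using \<alpha>_pos by (simp add: s1_def)
  have "\<alpha> * (e T - a) < 1 * (e T - a)" using \<open>a < e T\<close> \<alpha>_less by (intro mult_strict_right_mono) auto
  then show "s1 < e T" by (simp add: s1_def)
  show "e T < e t" using e_decreasing a0 by simp
qed

lemma \<tau>_bounds: "t \<le> \<tau> s" "\<tau> s \<le> U"
proof -
  have "t \<le> \<sigma> s \<and> \<sigma> s \<le> T" if "e T < s" "s < e t"
    using obtain_e[of s] that by (metis less_imp_le)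
  then show "t \<le> \<tau> s" "\<tau> s \<le> U" using a0 U_gt by (auto simp: \<tau>_def)
qed

lemma \<tau>_antimono: "antimono \<tau>"
proof (rule antimonoI)
  fix s r :: real assume "s \<le> r"
  show "\<tau> r \<le> \<tau> s"
  proof (cases "e T < s \<and> r < e t")
    case True
    obtain u where u: "t \<le> u" "u \<le> T" "e u = s" "\<sigma> s = u" using obtain_e[of s] True \<open>s \<le> r\<close> by auto
    obtain v where v: "t \<le> v" "v \<le> T" "e v = r" "\<sigma> r = v" using obtain_e[of r] True \<open>s \<le> r\<close> by auto
    have "v \<le> u" using e_decreasing[of u v] u v a0 \<open>s \<le> r\<close> by force
    then show ?thesis using True u v order \<open>s \<le> r\<close> by (simp add: \<tau>_def)
  next
    case False
    show ?thesis
    proof (cases "e t \<le> r")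
      case True
      then have "\<tau> r = t" using order by (simp add: \<tau>_def)
      then show ?thesis using \<tau>_bounds by simp
    next
      case 2: False
      then have "s \<le> e T" using False by simp
      have "\<tau> r \<le> T" if "s1 < r" using that obtain_e[of r] 2 a0 by (auto simp: \<tau>_def) force
      then show ?thesis using \<open>s \<le> e T\<close> \<open>s \<le> r\<close> U_gt \<tau>_bounds[of r] by (auto simp: \<tau>_def)
    qed
  qed
qed

lemma integral_const_piece:
  fixes h :: "real \<Rightarrow> real"
  assumes "c \<le> d" and "\<And>s. c < s \<Longrightarrow> s < d \<Longrightarrow> \<tau> s = r"
  shows "((\<lambda>s. h (\<tau> s)) has_integral (d - c) * h r) {c..d}"
proof (rule has_integral_spike_finite[of "{c, d}"])
  show "((\<lambda>s. h r) has_integral (d - c) * h r) {c..d}"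
    using has_integral_const_real[of "h r" c d] assms(1) by simp
qed (use assms in auto)

lemma integral_\<tau>_1:
  fixes h :: "real \<Rightarrow> real"
  assumes "a \<le> d" "d \<le> s1"
  shows "((\<lambda>s. h (\<tau> s)) has_integral (d - a) * h U) {a..d}"
  by (rule integral_const_piece) (use assms in \<open>auto simp: \<tau>_def\<close>)

lemma integral_\<tau>_2:
  fixes h :: "real \<Rightarrow> real"
  assumes "s1 \<le> d" "d \<le> e T"
  shows "((\<lambda>s. h (\<tau> s)) has_integral (s1 - a) * h U + (d - s1) * h T) {a..d}"
  by (rule has_integral_combine[OF _ _ integral_\<tau>_1 integral_const_piece])
    (use assms order in \<open>auto simp: \<tau>_def\<close>)

text \<open>The last term is the error of the truncation: the two-valued start has the average
  \<open>\<alpha> * h U + (1 - \<alpha>) * h T\<close> instead of \<open>w T\<close>. It vanishes for the coordinates of the curve and is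
  what has to be estimated for \<open>f\<close>.\<close>

lemma integral_\<tau>_3:
  assumes w: "solves_delivery a0 h w" and "t \<le> r" "r \<le> T"
  shows "((\<lambda>s. h (\<tau> s)) has_integral
    (e r - a) * w r + (e T - a) * (\<alpha> * h U + (1 - \<alpha>) * h T - w T)) {a..e r}"
proof -
  have er: "e T \<le> e r" "e r \<le> e t"
    using e_decreasing[of r T] e_decreasing[of t r] a0 assms
    by (cases "r = T"; cases "r = t"; auto)+
  have 1: "((\<lambda>s. h (\<tau> s)) has_integral (e r - a) * w r - (e T - a) * w T) {e T..e r}"
    by (rule has_integral_spike_finite[of "{e T, e r}", OF _ _ integral_\<sigma>[OF assms]])
      (use er order in \<open>auto simp: \<tau>_def\<close>)
  have 2: "(s1 - a) * h U + (e T - s1) * h T = (e T - a) * (\<alpha> * h U + (1 - \<alpha>) * h T)"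
    by (simp add: s1_def algebra_simps)
  have "((\<lambda>s. h (\<tau> s)) has_integral ((s1 - a) * h U + (e T - s1) * h T) +
      ((e r - a) * w r - (e T - a) * w T)) {a..e r}"
    by (rule has_integral_combine[OF _ er(1) integral_\<tau>_2 1]) (use order in auto)
  then show ?thesis unfolding 2 by (simp add: algebra_simps)
qed

lemma integral_\<tau>_4:
  assumes "solves_delivery a0 h w" and "e t \<le> d"
  shows "((\<lambda>s. h (\<tau> s)) has_integral
    (e t - a) * w t + (d - e t) * h t + (e T - a) * (\<alpha> * h U + (1 - \<alpha>) * h T - w T)) {a..d}"
proof -
  have "((\<lambda>s. h (\<tau> s)) has_integral ((e t - a) * w t + 
    (e T - a) * (\<alpha> * h U + (1 - \<alpha>) * h T - w T)) + (d - e t) * h t) {a..d}"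
    by (rule has_integral_combine[OF _ assms(2) integral_\<tau>_3[OF assms(1)] integral_const_piece])
      (use order a0 assms(2) in \<open>auto simp: \<tau>_def\<close>)
  then show ?thesis by (simp add: algebra_simps)
qed

lemma split_contact:
  "\<alpha> * x U + (1 - \<alpha>) * x T = X (s\<^sub>L T)" "\<alpha> * y U + (1 - \<alpha>) * y T = Y (s\<^sub>L T)"
proof -
  have *: "\<alpha> * (x U - x T) = width T"
    using lower.x_strict_mono[OF U_gt] by (simp add: \<alpha>_def)
  then show "\<alpha> * x U + (1 - \<alpha>) * x T = X (s\<^sub>L T)"
    by (simp add: width_def algebra_simps)
  have "y U - y T = \<kappa> T * (x U - x T)" using U_height by (simp add: height_s\<^sub>L_eq)
  then have "\<alpha> * (y U - y T) = \<kappa> T * width T" unfolding * [symmetric] by simp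
  then show "\<alpha> * y U + (1 - \<alpha>) * y T = Y (s\<^sub>L T)"
    by (simp add: Y_s\<^sub>L algebra_simps)
qed

lemma integral_to_contact:
  assumes "t \<le> r" "r \<le> T"
  shows "((\<lambda>s. x (\<tau> s)) has_integral (e r - a) * X (s\<^sub>L r)) {a..e r}"
    "((\<lambda>s. y (\<tau> s)) has_integral (e r - a) * Y (s\<^sub>L r)) {a..e r}"
  using integral_\<tau>_3[OF solves_delivery_contact(1) assms] 
    integral_\<tau>_3[OF solves_delivery_contact(2) assms]
  by (simp_all add: split_contact)

lemma integral_beyond_contact:
  assumes "e t \<le> d"
  shows "((\<lambda>s. x (\<tau> s)) has_integral (e t - a) * X (s\<^sub>L t) + (d - e t) * x t) {a..d}"
    "((\<lambda>s. y (\<tau> s)) has_integral (e t - a) * Y (s\<^sub>L t) + (d - e t) * y t) {a..d}"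
  using integral_\<tau>_4[OF solves_delivery_contact(1) assms] 
    integral_\<tau>_4[OF solves_delivery_contact(2) assms]
  by (simp_all add: split_contact)

lemma height_integral_combination:
  assumes "((\<lambda>s. x (\<tau> s)) has_integral (c1 * p1 + c2 * p2)) {a..d}"
    and "((\<lambda>s. y (\<tau> s)) has_integral (c1 * q1 + c2 * q2)) {a..d}"
    and "c1 + c2 = d - a" and "a < d"
    and "upper.tangent_at r p1 = q1" "upper.tangent_at r p2 = q2"
  shows "((\<lambda>s. height r (\<tau> s)) has_integral 0) {a..d}"
proof -
  define p q where "p = (c1 * p1 + c2 * p2) / (d - a)" and "q = (c1 * q1 + c2 * q2) / (d - a)"
  have pq: "c1 * p1 + c2 * p2 = (d - a) * p" "c1 * q1 + c2 * q2 = (d - a) * q"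
    using assms(4) by (simp_all add: p_def q_def)
  have "(d - a) * (upper.tangent_at r p - q)
      = (d - a) * (Y r - \<mu> r * X r) + \<mu> r * (c1 * p1 + c2 * p2) - (c1 * q1 + c2 * q2)"
    unfolding pq by (simp add: upper.tangent_at_def algebra_simps)
  also have "\<dots> = c1 * (upper.tangent_at r p1 - q1) + c2 * (upper.tangent_at r p2 - q2)"
    unfolding assms(3) [symmetric] by (simp add: upper.tangent_at_def algebra_simps)
  also have "\<dots> = 0" using assms by simp
  finally show ?thesis
    using height_integral[of \<tau> d a p q r] assms(1,2,4) by (simp add: pq)
qed

text \<open>On each of the four pieces the average over \<open>{a..d}\<close> is a convex combination of points on the
  tangent from the current value: the constant value itself, two intersections with the lower curve,
  the contact point, or the contact point and the source.\<close>

lemma balance: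
  assumes "a < d"
  shows "((\<lambda>s. height (s\<^sub>L (\<tau> d)) (\<tau> s)) has_integral 0) {a..d}"
proof -
  have on_line: "upper.tangent_at (s\<^sub>L r) (x r) = y r" for r
    using tangency_iff by blast
  have contact: "upper.tangent_at (s\<^sub>L r) (X (s\<^sub>L r)) = Y (s\<^sub>L r)" for r
    by (simp add: upper.tangent_at_def)
  consider "d \<le> s1" | "s1 < d" "d \<le> e T" | "e T < d" "d < e t" | "e t \<le> d" by force
  then show ?thesis
  proof cases
    case 1
    then have "\<tau> d = U" by (simp add: \<tau>_def)
    then show ?thesis
      using height_integral[OF integral_\<tau>_1[of d x] integral_\<tau>_1[of d y], where r = "s\<^sub>L U"] 1 assms on_line by simp
  next
    case 2
    then have "\<tau> d = T" by (simp add: \<tau>_def)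
    moreover have "upper.tangent_at (s\<^sub>L T) (x U) = y U" using U_height by (simp add: height_def)
    ultimately show ?thesis
      using height_integral_combination[OF integral_\<tau>_2[of d x] integral_\<tau>_2[of d y]] 2 assms on_line by simp
  next
    case 3
    then obtain r where r: "t \<le> r" "r \<le> T" "e r = d" "\<sigma> d = r" using obtain_e[of d] by auto
    then have "\<tau> d = r" using 3 order by (simp add: \<tau>_def)
    then show ?thesis
      using height_integral[OF integral_to_contact[OF r(1,2), unfolded r(3)], where r = "s\<^sub>L r"] r contact assms by simp
  next
    case 4
    then have "\<tau> d = t" using order by (simp add: \<tau>_def)
    then show ?thesis
      using height_integral_combination[OF integral_beyond_contact[OF 4]] assms contact on_line by simp
  qed
qed

lemma average_\<tau>_in_some_segment:
  assumes "a \<le> c" "c < d"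
    and "((\<lambda>s. x (\<tau> s)) has_integral (d - c) * p) {c..d}"
    and "((\<lambda>s. y (\<tau> s)) has_integral (d - c) * q) {c..d}"
  shows "\<exists>r. segment_point r p q"
  by (rule average_in_some_segment[OF _ balance assms])
    (use assms \<tau>_antimono in \<open>auto simp: monotone_on_def\<close>)

end

section \<open>Stieltjes integrals\<close>

lemma tagged_interval:
  fixes a b :: real
  assumes "p tagged_division_of {a..b}" and "(z, k) \<in> p"
  obtains l u where "k = {l..u}" "l \<le> u" "a \<le> l" "u \<le> b" "z \<in> {a..b}"
proof -
  obtain l u where k: "k = cbox l u" using tagged_division_ofD(4)[OF assms] by blast
  moreover have "z \<in> k" "k \<subseteq> {a..b}" using tagged_division_ofD(2,3)[OF assms] by auto
  ultimately show ?thesis using that[of l u] by (auto simp: subset_eq)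
qed

lemma stieltjes_fine_division:
  fixes a b :: real
  assumes "0 < d"
  obtains p where "p tagged_division_of {a..b}" and "(\<lambda>x. ball x d) fine p"
  using fine_division_exists_real[OF gauge_ball[OF assms], of a b] by blast

definition stieltjes_sum :: "(real \<Rightarrow> real) \<Rightarrow> (real \<Rightarrow> real) \<Rightarrow> (real \<times> real set) set \<Rightarrow> real" where
  "stieltjes_sum h F p = (\<Sum>(x, k)\<in>p. h x * (F (Sup k) - F (Inf k)))"

lemma has_stieltjes_integralD:
  assumes "has_stieltjes_integral h F a b y" and "0 < e"
  shows "\<exists>d>0. \<forall>p. p tagged_division_of {a..b} \<longrightarrow> (\<lambda>x. ball x d) fine p \<longrightarrow>
      \<bar>stieltjes_sum h F p - y\<bar> < e"
  using assms unfolding has_stieltjes_integral_def stieltjes_sum_def imp_conjL by blast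

lemma has_stieltjes_integralI:
  assumes "\<And>e. 0 < e \<Longrightarrow> \<exists>d>0. \<forall>p. p tagged_division_of {a..b} \<longrightarrow> (\<lambda>x. ball x d) fine p \<longrightarrow>
      \<bar>stieltjes_sum h F p - y\<bar> < e"
  shows "has_stieltjes_integral h F a b y"
  using assms unfolding has_stieltjes_integral_def stieltjes_sum_def imp_conjL by blast

text \<open>The union of fine tagged divisions of the two parts is one of the whole interval; a tagged interval
  that occurs in both is a single point and contributes nothing.\<close>

lemma stieltjes_integral_split:
  assumes "has_stieltjes_integral h F a b y" "has_stieltjes_integral h F a c y1"
    and "has_stieltjes_integral h F c b y2" and "a \<le> c" "c \<le> b"
  shows "y = y1 + y2"
proof (rule ccontr)
  assume ne: "y \<noteq> y1 + y2"
  define e where "e = \<bar>y - (y1 + y2)\<bar> / 3"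
  have "0 < e" using ne by (simp add: e_def)
  define S where "S = stieltjes_sum h F"
  obtain d where d: "0 < d" "\<And>p. p tagged_division_of {a..b} \<Longrightarrow> (\<lambda>x. ball x d) fine p \<Longrightarrow> \<bar>S p - y\<bar> < e"
    using has_stieltjes_integralD[OF assms(1) \<open>0 < e\<close>] unfolding S_def by blast
  obtain d1 where d1: "0 < d1" "\<And>p. p tagged_division_of {a..c} \<Longrightarrow> (\<lambda>x. ball x d1) fine p \<Longrightarrow> \<bar>S p - y1\<bar> < e"
    using has_stieltjes_integralD[OF assms(2) \<open>0 < e\<close>] unfolding S_def by blast
  obtain d2 where d2: "0 < d2" "\<And>p. p tagged_division_of {c..b} \<Longrightarrow> (\<lambda>x. ball x d2) fine p \<Longrightarrow> \<bar>S p - y2\<bar> < e"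
    using has_stieltjes_integralD[OF assms(3) \<open>0 < e\<close>] unfolding S_def by blast
  define m where "m = min d (min d1 d2)"
  have m: "0 < m" "m \<le> d" "m \<le> d1" "m \<le> d2" using d d1 d2 by (auto simp: m_def)
  have mono: "(\<lambda>x. ball x m) fine p \<Longrightarrow> m \<le> d' \<Longrightarrow> (\<lambda>x. ball x d') fine p" for p d'
    unfolding fine_def using subset_ball by blast
  obtain p1 where p1: "p1 tagged_division_of {a..c}" "(\<lambda>x. ball x m) fine p1"
    by (rule stieltjes_fine_division[OF m(1)])
  obtain p2 where p2: "p2 tagged_division_of {c..b}" "(\<lambda>x. ball x m) fine p2"
    by (rule stieltjes_fine_division[OF m(1)])
  have "interior {a..c} \<inter> interior {c..b} = {}" by auto
  then have "p1 \<union> p2 tagged_division_of ({a..c} \<union> {c..b})"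
    by (rule tagged_division_Un[OF p1(1) p2(1)])
  moreover have "{a..c} \<union> {c..b} = {a..b}" using assms(4,5) by auto
  ultimately have p: "p1 \<union> p2 tagged_division_of {a..b}" by simp
  have "S (p1 \<union> p2) = S p1 + S p2"
    unfolding S_def stieltjes_sum_def
  proof (rule sum.union_inter_neutral)
    show "finite p1" "finite p2" using p1(1) p2(1) by (auto intro: tagged_division_of_finite)
    show "\<forall>z\<in>p1 \<inter> p2. (case z of (x, k) \<Rightarrow> h x * (F (Sup k) - F (Inf k))) = 0"
    proof safe
      fix z k assume zk: "(z, k) \<in> p1" "(z, k) \<in> p2"
      obtain l u where 1: "k = {l..u}" "l \<le> u" "u \<le> c" using tagged_interval[OF p1(1) zk(1)] by metis
      obtain l' u' where 2: "k = {l'..u'}" "l' \<le> u'" "c \<le> l'" using tagged_interval[OF p2(1) zk(2)] by metis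
      have "l = c" "u = c" using 1 2 by (auto simp: Icc_eq_Icc)
      then show "h z * (F (Sup k) - F (Inf k)) = 0" using 1 by simp
    qed
  qed
  moreover have "\<bar>S (p1 \<union> p2) - y\<bar> < e"
    by (rule d(2)[OF p]) (rule fine_Un[OF mono[OF p1(2) m(2)] mono[OF p2(2) m(2)]])
  moreover have "\<bar>S p1 - y1\<bar> < e" by (rule d1(2)[OF p1(1)]) (rule mono[OF p1(2) m(3)])
  moreover have "\<bar>S p2 - y2\<bar> < e" by (rule d2(2)[OF p2(1)]) (rule mono[OF p2(2) m(4)])
  ultimately have "\<bar>y - (y1 + y2)\<bar> < 3 * e" by linarith
  then show False by (simp add: e_def)
qed

lemma stieltjes_integral_point: "has_stieltjes_integral h F a a 0"
proof -
  have "stieltjes_sum h F p = 0" if p: "p tagged_division_of {a..a}" for p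
    unfolding stieltjes_sum_def
  proof (rule sum.neutral, safe)
    fix z k assume "(z, k) \<in> p"
    from tagged_interval[OF p this] obtain l u where "k = {l..u}" "l \<le> u" "a \<le> l" "u \<le> a" by metis
    then have "k = {a..a}" by auto
    then show "h z * (F (Sup k) - F (Inf k)) = 0" by simp
  qed
  then show ?thesis by (intro has_stieltjes_integralI exI[of _ 1]) simp
qed

lemma stieltjes_integral_unique:
  assumes "has_stieltjes_integral h F a b y" "has_stieltjes_integral h F a b y'" and "a \<le> b"
  shows "y = y'"
  using stieltjes_integral_split[OF assms(1) stieltjes_integral_point assms(2)] assms(3) by simp

lemma stieltjes_integral_at_top_unique:
  assumes "has_stieltjes_integral_at_top h F a y" "has_stieltjes_integral_at_top h F a y'"
  shows "y = y'"
proof -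
  obtain Y Y' where Y: "\<And>b. a \<le> b \<Longrightarrow> has_stieltjes_integral h F a b (Y b)" "(Y \<longlongrightarrow> y) at_top"
    "\<And>b. a \<le> b \<Longrightarrow> has_stieltjes_integral h F a b (Y' b)" "(Y' \<longlongrightarrow> y') at_top"
    using assms unfolding has_stieltjes_integral_at_top_def by metis
  have "\<forall>\<^sub>F b in at_top. Y b = Y' b"
    using eventually_ge_at_top[of a] by eventually_elim (use Y stieltjes_integral_unique in blast)
  then have "(Y' \<longlongrightarrow> y) at_top" using Y(2) by (rule Lim_transform_eventually[rotated])
  then show ?thesis using Y(4) tendsto_unique trivial_limit_at_top_linorder by blast
qed

lemma stieltjes_integral_at_top_eq:
  assumes "has_stieltjes_integral_at_top h F a y"
  shows "stieltjes_integral_at_top h F a = y"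
  unfolding stieltjes_integral_at_top_def
  using assms stieltjes_integral_at_top_unique by blast

lemma stieltjes_integral_scale:
  assumes "has_stieltjes_integral h F a b y" and "\<And>s. s \<in> {a..b} \<Longrightarrow> h' s = c * h s"
  shows "has_stieltjes_integral h' F a b (c * y)"
proof (rule has_stieltjes_integralI)
  fix e :: real assume "0 < e"
  then have "0 < e / (\<bar>c\<bar> + 1)" by simp
  then obtain d where d: "0 < d" "\<And>p. p tagged_division_of {a..b} \<Longrightarrow> (\<lambda>x. ball x d) fine p \<Longrightarrow>
      \<bar>stieltjes_sum h F p - y\<bar> < e / (\<bar>c\<bar> + 1)"
    using has_stieltjes_integralD[OF assms(1)] by blast
  have "\<bar>stieltjes_sum h' F p - c * y\<bar> < e"
    if p: "p tagged_division_of {a..b}" "(\<lambda>x. ball x d) fine p" for p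
  proof -
    have "stieltjes_sum h' F p = (\<Sum>(x, k)\<in>p. c * (h x * (F (Sup k) - F (Inf k))))"
      unfolding stieltjes_sum_def
    proof (rule sum.cong[OF refl], safe)
      fix z k assume "(z, k) \<in> p"
      from tagged_interval[OF p(1) this] have "z \<in> {a..b}" by metis
      then show "h' z * (F (Sup k) - F (Inf k)) = c * (h z * (F (Sup k) - F (Inf k)))"
        using assms(2) by simp
    qed
    also have "\<dots> = c * stieltjes_sum h F p"
      by (simp add: stieltjes_sum_def sum_distrib_left split_def)
    finally have "\<bar>stieltjes_sum h' F p - c * y\<bar> = \<bar>c\<bar> * \<bar>stieltjes_sum h F p - y\<bar>"
      by (simp add: abs_mult [symmetric] right_diff_distrib)
    also have "\<dots> \<le> \<bar>c\<bar> * (e / (\<bar>c\<bar> + 1))"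
      using d(2)[OF p] by (intro mult_left_mono) auto
    also have "\<dots> < e" using \<open>0 < e\<close> by (simp add: field_simps)
    finally show ?thesis .
  qed
  then show "\<exists>d>0. \<forall>p. p tagged_division_of {a..b} \<longrightarrow> (\<lambda>x. ball x d) fine p \<longrightarrow>
      \<bar>stieltjes_sum h' F p - c * y\<bar> < e"
    using d(1) by blast
qed

lemma stieltjes_integral_nonpos:
  assumes "has_stieltjes_integral h F a b y" and "antimono_on {a..b} F"
    and "\<And>s. s \<in> {a..b} \<Longrightarrow> 0 \<le> h s"
  shows "y \<le> 0"
proof (rule ccontr)
  assume "\<not> y \<le> 0"
  then obtain d where d: "0 < d" "\<And>p. p tagged_division_of {a..b} \<Longrightarrow> (\<lambda>x. ball x d) fine p \<Longrightarrow>
      \<bar>stieltjes_sum h F p - y\<bar> < y"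
    using has_stieltjes_integralD[OF assms(1), of y] by auto
  obtain p where p: "p tagged_division_of {a..b}" "(\<lambda>x. ball x d) fine p"
    by (rule stieltjes_fine_division[OF d(1)])
  have "stieltjes_sum h F p \<le> 0"
    unfolding stieltjes_sum_def
  proof (rule sum_nonpos, safe)
    fix z k assume "(z, k) \<in> p"
    from tagged_interval[OF p(1) this] obtain l u
      where k: "k = {l..u}" "l \<le> u" "a \<le> l" "u \<le> b" "z \<in> {a..b}" by metis
    have "F u \<le> F l" by (rule monotone_onD[OF assms(2)]) (use k in auto)
    then show "h z * (F (Sup k) - F (Inf k)) \<le> 0"
      using k assms(3) by (auto intro!: mult_nonneg_nonpos)
  qed
  then show False using d(2)[OF p] by linarith
qed

lemma stieltjes_integral_at_top_nonpos:
  assumes "has_stieltjes_integral_at_top h F a y" and "antimono_on {a..} F"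
    and "\<And>s. a \<le> s \<Longrightarrow> 0 \<le> h s"
  shows "y \<le> 0"
proof -
  obtain Y where Y: "\<And>b. a \<le> b \<Longrightarrow> has_stieltjes_integral h F a b (Y b)" "(Y \<longlongrightarrow> y) at_top"
    using assms unfolding has_stieltjes_integral_at_top_def by metis
  have "\<forall>\<^sub>F b in at_top. Y b \<le> 0"
    using eventually_ge_at_top[of a]
  proof eventually_elim
    case (elim b)
    have "antimono_on {a..b} F" by (rule monotone_on_subset[OF assms(2)]) auto
    then show ?case using stieltjes_integral_nonpos[OF Y(1)[OF elim]] assms(3) by auto
  qed
  then show ?thesis using tendsto_upperbound[OF Y(2)] by simp
qed

text \<open>By multiplicativity of \<open>E\<close>, the product \<open>E t T * y T\<close> is the part beyond \<open>T\<close> of the integral that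
  defines \<open>y t\<close>.\<close>

lemma stieltjes_tail_tendsto_0:
  assumes tails: "\<And>T. t \<le> T \<Longrightarrow> has_stieltjes_integral_at_top (E T) F T (y T)"
    and mult: "\<And>T s. t \<le> T \<Longrightarrow> T \<le> s \<Longrightarrow> E t s = E t T * E T s"
  shows "((\<lambda>T. E t T * y T) \<longlongrightarrow> 0) at_top"
proof -
  obtain Y where Y: "\<And>b. t \<le> b \<Longrightarrow> has_stieltjes_integral (E t) F t b (Y b)" "(Y \<longlongrightarrow> y t) at_top"
    using tails[of t] unfolding has_stieltjes_integral_at_top_def by auto
  have eq: "E t T * y T = y t - Y T" if T: "t \<le> T" for T
  proof -
    obtain Z where Z: "\<And>b. T \<le> b \<Longrightarrow> has_stieltjes_integral (E T) F T b (Z b)" "(Z \<longlongrightarrow> y T) at_top"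
      using tails[OF T] unfolding has_stieltjes_integral_at_top_def by auto
    have "\<forall>\<^sub>F b in at_top. Y T + E t T * Z b = Y b"
      using eventually_ge_at_top[of T]
    proof eventually_elim
      case (elim b)
      have "has_stieltjes_integral (E t) F T b (E t T * Z b)"
        by (rule stieltjes_integral_scale[OF Z(1)[OF elim]]) (rule mult[OF T], simp)
      moreover have "has_stieltjes_integral (E t) F t b (Y b)" by (rule Y(1)) (use T elim in simp)
      ultimately show ?case
        using stieltjes_integral_split[OF _ Y(1)[OF T] _ T elim] by simp
    qed
    moreover have "((\<lambda>b. Y T + E t T * Z b) \<longlongrightarrow> Y T + E t T * y T) at_top"
      by (intro tendsto_intros Z)
    ultimately have "(Y \<longlongrightarrow> Y T + E t T * y T) at_top"
      by (rule Lim_transform_eventually[rotated])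
    then have "y t = Y T + E t T * y T"
      using Y(2) tendsto_unique trivial_limit_at_top_linorder by blast
    then show ?thesis by simp
  qed
  have "\<forall>\<^sub>F T in at_top. y t - Y T = E t T * y T"
    using eventually_ge_at_top[of t] by eventually_elim (simp add: eq)
  moreover have "((\<lambda>T. y t - Y T) \<longlongrightarrow> y t - y t) at_top"
    by (intro tendsto_intros Y)
  ultimately show ?thesis by (simp add: Lim_transform_eventually)
qed

section \<open>The candidate along the contact points\<close>

text \<open>The equation for \<open>\<beta>\<close> is \<open>\<beta>\<^sub>2' = - \<kappa>\<^sub>2' / (\<kappa>\<^sub>2 - \<kappa>) * (\<beta>\<^sub>2 - K)\<close>, in which the Stieltjes integral is
  expressed as \<open>\<beta>\<^sub>2 - K\<close>.\<close>

locale candidate = curve_pair +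
  fixes f \<kappa>\<^sub>3 K \<beta> :: "real \<Rightarrow> real" and v :: real
  assumes f_deriv: "\<And>t. (f has_real_derivative \<kappa>\<^sub>3 t * x' t) (at t)"
    and \<kappa>\<^sub>3_deriv: "\<And>t. (\<kappa>\<^sub>3 has_real_derivative K t * \<kappa>\<^sub>2' t) (at t)"
    and \<beta>_deriv: "\<And>t. v < t \<Longrightarrow>
      (\<beta> has_real_derivative \<kappa>\<^sub>2' t / (\<kappa> t - \<kappa>\<^sub>2 t) * (\<beta> t - K t)) (at t)"
    and \<beta>_greater: "\<And>t. v < t \<Longrightarrow> K t < \<beta> t"
begin

text \<open>The value of the candidate at the contact point of the left tangent from \<open>t\<close>.\<close>

definition contact_value :: "real \<Rightarrow> real" where
  "contact_value t = f t + width t * (\<kappa>\<^sub>3 t + (\<kappa> t - \<kappa>\<^sub>2 t) * \<beta> t)"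

lemma solves_delivery_contact_value: "solves_delivery v f contact_value"
  unfolding solves_delivery_def
proof (intro allI impI)
  fix t assume t: "v < t"
  define c where "c = \<kappa> t - \<kappa>\<^sub>2 t"
  have c: "c \<noteq> 0" "width t \<noteq> 0" using \<kappa>_greater[of t] width_pos[of t] by (auto simp: c_def)
  have "((\<lambda>t. f t + width t * (\<kappa>\<^sub>3 t + (\<kappa> t - \<kappa>\<^sub>2 t) * \<beta> t)) has_real_derivative
      \<kappa>\<^sub>3 t * x' t + ((X\<^sub>L' t - x' t) * (\<kappa>\<^sub>3 t + c * \<beta> t) +
       (K t * \<kappa>\<^sub>2' t + ((x' t * c / width t - \<kappa>\<^sub>2' t) * \<beta> t + \<kappa>\<^sub>2' t / c * (\<beta> t - K t) * c)) * width t)) (at t)"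
    unfolding c_def
    by (rule DERIV_add DERIV_mult DERIV_diff f_deriv width_deriv \<kappa>\<^sub>3_deriv \<kappa>_deriv
        lower.k_deriv \<beta>_deriv[OF t])+
  moreover have "\<kappa>\<^sub>3 t * x' t + ((X\<^sub>L' t - x' t) * (\<kappa>\<^sub>3 t + c * \<beta> t) +
       (K t * \<kappa>\<^sub>2' t + ((x' t * c / width t - \<kappa>\<^sub>2' t) * \<beta> t + \<kappa>\<^sub>2' t / c * (\<beta> t - K t) * c)) * width t)
      = X\<^sub>L' t * (\<kappa>\<^sub>3 t + c * \<beta> t)"
  proof -
    have "\<kappa>\<^sub>2' t / c * (\<beta> t - K t) * c = \<kappa>\<^sub>2' t * (\<beta> t - K t)" using c by simp
    moreover have "(x' t * c / width t) * \<beta> t * width t = x' t * c * \<beta> t" using c by simp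
    ultimately show ?thesis using c by (simp add: algebra_simps)
  qed
  moreover have "X\<^sub>L' t * (\<kappa>\<^sub>3 t + c * \<beta> t) = rate t * (f t - contact_value t)"
    using c by (simp add: rate_def contact_value_def c_def)
  ultimately show "(contact_value has_real_derivative rate t * (f t - contact_value t)) (at t)"
    by (simp add: contact_value_def[abs_def])
qed

text \<open>Let \<open>F s\<close> and \<open>H s\<close> be the heights of \<open>f\<close> and \<open>y\<close> at \<open>U\<close> over their tangents at \<open>s\<close>, as functions of
  the abscissa. Then \<open>F' = K * H'\<close> with \<open>H' \<le> 0\<close>, and \<open>F\<close> and \<open>H\<close> vanish at \<open>U\<close>; hence \<open>K T * H T \<le> F T\<close>
  if \<open>K\<close> increases. The bound \<open>F T \<le> \<beta> T * H T\<close> holds because \<open>F - \<beta> * H\<close> increases: by the equation for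
  \<open>\<beta>\<close> the sign of its derivative is that of \<open>(\<kappa> s - \<kappa>\<^sub>2 s) * (x U - x s) - H s\<close>, the height over \<open>U\<close> of
  the left tangent from \<open>s\<close>. The defect itself is a positive multiple of \<open>\<beta> T * H T - F T\<close>.\<close>

lemma chord_defect:
  assumes "v < T" and K_mono: "mono_on {T..} K"
  defines "U \<equiv> right_intersection T"
  defines "\<alpha> \<equiv> width T / (x U - x T)"
  shows "\<bar>\<alpha> * f U + (1 - \<alpha>) * f T - contact_value T\<bar> \<le> width T * (\<kappa> T - \<kappa>\<^sub>2 T) * (\<beta> T - K T)"
proof -
  have TU: "T < U" "height (s\<^sub>L T) U = 0" using right_intersection[of T] by (simp_all add: U_def)
  have dx: "0 < x U - x T" using lower.x_strict_mono[OF TU(1)] by simp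
  define F where "F = (\<lambda>s. f U - f s - \<kappa>\<^sub>3 s * (x U - x s))"
  define H where "H = (\<lambda>s. y U - y s - \<kappa>\<^sub>2 s * (x U - x s))"
  have F': "(F has_real_derivative K s * (- \<kappa>\<^sub>2' s * (x U - x s))) (at s)" for s
    unfolding F_def
    by (rule derivative_eq_intros f_deriv \<kappa>\<^sub>3_deriv lower.x_deriv refl)+ (simp add: algebra_simps)
  have H': "(H has_real_derivative - \<kappa>\<^sub>2' s * (x U - x s)) (at s)" for s
    unfolding H_def
    by (rule derivative_eq_intros lower.y_deriv lower.k_deriv lower.x_deriv refl)+ (simp add: algebra_simps)
  have lower_bound: "K T * H T \<le> F T"
  proof -
    have "F U - K T * H U \<le> F T - K T * H T"
    proof (rule DERIV_nonpos_imp_nonincreasing[of T U "\<lambda>s. F s - K T * H s"])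
      fix s assume s: "T \<le> s" "s \<le> U"
      have "((\<lambda>s. F s - K T * H s) has_real_derivative
          K s * (- \<kappa>\<^sub>2' s * (x U - x s)) - K T * (- \<kappa>\<^sub>2' s * (x U - x s))) (at s)"
        by (intro DERIV_diff F' DERIV_cmult H')
      moreover have "K T \<le> K s" by (rule mono_onD[OF K_mono]) (use s in auto)
      then have "0 \<le> (K s - K T) * (\<kappa>\<^sub>2' s * (x U - x s))"
        using lower.k'_pos[of s] s lower.x_le_iff by (intro mult_nonneg_nonneg) (auto simp: less_imp_le)
      then have "K s * (- \<kappa>\<^sub>2' s * (x U - x s)) - K T * (- \<kappa>\<^sub>2' s * (x U - x s)) \<le> 0"
        by (simp add: algebra_simps)
      ultimately show "\<exists>y. ((\<lambda>s. F s - K T * H s) has_real_derivative y) (at s) \<and> y \<le> 0" by blast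
    qed (use TU in simp)
    then show ?thesis by (simp add: F_def H_def)
  qed
  have upper_bound: "F T \<le> \<beta> T * H T"
  proof -
    have "F T - \<beta> T * H T \<le> F U - \<beta> U * H U"
    proof (rule DERIV_nonneg_imp_nondecreasing[of T U "\<lambda>s. F s - \<beta> s * H s"])
      fix s assume s: "T \<le> s" "s \<le> U"
      then have "v < s" using assms(1) by simp
      define c where "c = \<kappa> s - \<kappa>\<^sub>2 s"
      have c: "0 < c" using \<kappa>_greater[of s] by (simp add: c_def)
      define D where "D = K s * (- \<kappa>\<^sub>2' s * (x U - x s)) -
          (\<kappa>\<^sub>2' s / c * (\<beta> s - K s) * H s + (- \<kappa>\<^sub>2' s * (x U - x s)) * \<beta> s)"
      have "((\<lambda>s. F s - \<beta> s * H s) has_real_derivative D) (at s)"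
        unfolding D_def c_def by (intro DERIV_diff F' DERIV_mult H' \<beta>_deriv \<open>v < s\<close>)
      moreover have "D = (\<beta> s - K s) * (\<kappa>\<^sub>2' s / c) * (c * (x U - x s) - H s)"
        using c by (simp add: D_def field_simps)
      moreover have "0 \<le> c * (x U - x s) - H s"
        using right_intersection_height_nonneg[of T s] s
        by (simp add: U_def [symmetric] height_s\<^sub>L_eq H_def c_def algebra_simps)
      ultimately show "\<exists>y. ((\<lambda>s. F s - \<beta> s * H s) has_real_derivative y) (at s) \<and> 0 \<le> y"
        using \<beta>_greater[OF \<open>v < s\<close>] lower.k'_pos[of s] c
        by (auto intro!: exI[of _ D])
    qed (use TU in simp)
    then show ?thesis by (simp add: F_def H_def)
  qed
  have H: "H T = (\<kappa> T - \<kappa>\<^sub>2 T) * (x U - x T)"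
    using TU(2) by (simp add: height_s\<^sub>L_eq H_def algebra_simps)
  have \<alpha>: "0 < \<alpha>" "\<alpha> * (x U - x T) = width T"
    using width_pos[of T] dx by (simp_all add: \<alpha>_def)
  have "contact_value T - (\<alpha> * f U + (1 - \<alpha>) * f T) = \<alpha> * (\<beta> T * H T - F T)"
    unfolding contact_value_def H F_def \<alpha>(2) [symmetric] by (simp add: algebra_simps)
  moreover have "0 \<le> \<alpha> * (\<beta> T * H T - F T)" using upper_bound \<alpha>(1) by simp
  moreover have "\<alpha> * (\<beta> T * H T - F T) \<le> \<alpha> * ((\<beta> T - K T) * H T)"
    using lower_bound \<alpha>(1) by (intro mult_left_mono) (auto simp: algebra_simps)
  moreover have "\<alpha> * ((\<beta> T - K T) * H T) = width T * (\<kappa> T - \<kappa>\<^sub>2 T) * (\<beta> T - K T)"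
    unfolding H \<alpha>(2) [symmetric] by (simp add: algebra_simps)
  ultimately show ?thesis by linarith
qed

section \<open>Letting the truncation tend to infinity\<close>

text \<open>The exponential weight in the Stieltjes integral that defines \<open>\<beta>\<^sub>2\<close>.\<close>

definition weight :: "real \<Rightarrow> real \<Rightarrow> real" where
  "weight t T = exp (integral {t..T} (\<lambda>u. \<kappa>\<^sub>2' u / (\<kappa>\<^sub>2 u - \<kappa> u)))"

lemma continuous_\<kappa>: "continuous_on A \<kappa>"
  by (meson DERIV_isCont continuous_at_imp_continuous_on \<kappa>_deriv)

lemma continuous_weight_exponent: "continuous_on A (\<lambda>u. \<kappa>\<^sub>2' u / (\<kappa>\<^sub>2 u - \<kappa> u))"
proof -
  have "\<kappa>\<^sub>2 u - \<kappa> u \<noteq> 0" for u using \<kappa>_greater[of u] by simp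
  then show ?thesis
    by (intro continuous_intros continuous_\<kappa> lower.continuous_k
        continuous_on_subset[OF continuous_\<kappa>\<^sub>2']) auto
qed

lemma integral_weight_exponent:
  assumes "a \<le> t" "t \<le> T"
  shows "integral {a..T} (\<lambda>u. \<kappa>\<^sub>2' u / (\<kappa>\<^sub>2 u - \<kappa> u)) =
    integral {a..t} (\<lambda>u. \<kappa>\<^sub>2' u / (\<kappa>\<^sub>2 u - \<kappa> u)) +
    integral {t..T} (\<lambda>u. \<kappa>\<^sub>2' u / (\<kappa>\<^sub>2 u - \<kappa> u))"
  using Henstock_Kurzweil_Integration.integral_combine[OF assms
      integrable_continuous_real[OF continuous_weight_exponent]] by simp

lemma weight_mult: "a \<le> t \<Longrightarrow> t \<le> T \<Longrightarrow> weight a T = weight a t * weight t T"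
  unfolding weight_def using integral_weight_exponent[of a t T] by (simp add: exp_add)

text \<open>The logarithmic derivatives of \<open>width\<close> and \<open>\<kappa> - \<kappa>\<^sub>2\<close> show that \<open>rate\<close> is the logarithmic derivative of
  \<open>weight t / (width * (\<kappa> - \<kappa>\<^sub>2))\<close>. So the mass of the past has a closed form, in which the denominator
  is exactly the factor that appears in the truncation error.\<close>

lemma obtain_delivery_mass:
  assumes "v < t" "0 < m"
  obtains a0 e where "v < a0" "a0 < t" "e t = a + m"
    and "\<And>r. a0 < r \<Longrightarrow> a < e r"
    and "\<And>r. a0 < r \<Longrightarrow> (e has_real_derivative rate r * (e r - a)) (at r)"
    and "\<And>T. t \<le> T \<Longrightarrow> (e T - a) * (width T * (\<kappa> T - \<kappa>\<^sub>2 T)) =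
      m * (width t * (\<kappa> t - \<kappa>\<^sub>2 t)) * weight t T"
proof -
  \<comment> \<open>The weight is only used from \<open>t\<close> on; integrating from a point between \<open>v\<close> and \<open>t\<close> extends it
    differentiably to the left of \<open>t\<close>.\<close>
  define a0 where "a0 = (v + t) / 2"
  have a0: "v < a0" "a0 < t" using assms by (auto simp: a0_def)
  define P where "P r = integral {a0..r} (\<lambda>u. \<kappa>\<^sub>2' u / (\<kappa>\<^sub>2 u - \<kappa> u))" for r
  define W where "W r = width r * (\<kappa> r - \<kappa>\<^sub>2 r)" for r
  have W: "0 < W r" for r using width_pos \<kappa>_greater by (simp add: W_def)
  define e where "e r = a + m * W t * exp (P r - P t) / W r" for r
  have P': "(P has_real_derivative \<kappa>\<^sub>2' r / (\<kappa>\<^sub>2 r - \<kappa> r)) (at r)" if "a0 < r" for r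
  proof -
    have "(P has_real_derivative \<kappa>\<^sub>2' r / (\<kappa>\<^sub>2 r - \<kappa> r)) (at r within {a0..r + 1})"
      unfolding P_def
      by (rule integral_has_real_derivative[OF continuous_weight_exponent]) (use that in auto)
    then show ?thesis using that by (simp add: at_within_Icc_at)
  qed
  have W': "(W has_real_derivative (X\<^sub>L' r - x' r) * (\<kappa> r - \<kappa>\<^sub>2 r) +
      (x' r * (\<kappa> r - \<kappa>\<^sub>2 r) / width r - \<kappa>\<^sub>2' r) * width r) (at r)" for r
    unfolding W_def[abs_def]
    by (rule DERIV_mult width_deriv DERIV_diff \<kappa>_deriv lower.k_deriv)+
  have W'_eq: "(X\<^sub>L' r - x' r) * (\<kappa> r - \<kappa>\<^sub>2 r) + (x' r * (\<kappa> r - \<kappa>\<^sub>2 r) / width r - \<kappa>\<^sub>2' r) * width r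
      = X\<^sub>L' r * (\<kappa> r - \<kappa>\<^sub>2 r) - \<kappa>\<^sub>2' r * width r" for r
  proof -
    have "x' r * (\<kappa> r - \<kappa>\<^sub>2 r) / width r * width r = x' r * (\<kappa> r - \<kappa>\<^sub>2 r)"
      using width_pos[of r] by simp
    then show ?thesis unfolding left_diff_distrib[of _ _ "width r"] by (simp add: algebra_simps)
  qed
  have e': "(e has_real_derivative rate r * (e r - a)) (at r)" if "a0 < r" for r
  proof -
    define c d Q where "c = \<kappa> r - \<kappa>\<^sub>2 r" and "d = width r" and "Q = m * W t * exp (P r - P t)"
    have cd: "0 < c" "0 < d" using width_pos \<kappa>_greater by (simp_all add: c_def d_def)
    have "((\<lambda>r. exp (P r - P t)) has_real_derivative
        exp (P r - P t) * (\<kappa>\<^sub>2' r / (\<kappa>\<^sub>2 r - \<kappa> r) - 0)) (at r)"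
      by (rule DERIV_fun_exp[OF DERIV_diff[OF P'[OF that] DERIV_const]])
    from DERIV_cmult[OF this, of "m * W t"]
    have "((\<lambda>r. m * W t * exp (P r - P t)) has_real_derivative
        Q * (\<kappa>\<^sub>2' r / (\<kappa>\<^sub>2 r - \<kappa> r))) (at r)" by (simp add: Q_def mult.assoc)
    from DERIV_add[OF DERIV_const[of a] DERIV_divide[OF this W']] W[of r]
    have "(e has_real_derivative
        (Q * (\<kappa>\<^sub>2' r / (\<kappa>\<^sub>2 r - \<kappa> r)) * W r - Q * (X\<^sub>L' r * c - \<kappa>\<^sub>2' r * d)) / (W r * W r)) (at r)"
      unfolding W'_eq by (simp add: e_def[abs_def] Q_def c_def d_def)
    moreover have "(Q * (\<kappa>\<^sub>2' r / (\<kappa>\<^sub>2 r - \<kappa> r)) * W r - Q * (X\<^sub>L' r * c - \<kappa>\<^sub>2' r * d)) / (W r * W r)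
        = rate r * (e r - a)"
    proof -
      have Wr: "W r = d * c" by (simp add: W_def c_def d_def)
      have "\<kappa>\<^sub>2 r - \<kappa> r = - c" by (simp add: c_def)
      then have "Q * (\<kappa>\<^sub>2' r / (\<kappa>\<^sub>2 r - \<kappa> r)) * W r = - Q * \<kappa>\<^sub>2' r * d"
        using cd by (simp add: Wr)
      then have "(Q * (\<kappa>\<^sub>2' r / (\<kappa>\<^sub>2 r - \<kappa> r)) * W r - Q * (X\<^sub>L' r * c - \<kappa>\<^sub>2' r * d)) / (W r * W r)
          = - (Q * X\<^sub>L' r * c) / (d * c * (d * c))"
        by (simp add: Wr algebra_simps)
      also have "\<dots> = - X\<^sub>L' r / d * (Q / (d * c))" using cd by (simp add: field_simps)
      also have "\<dots> = rate r * (e r - a)"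
        by (simp add: rate_def e_def Q_def Wr d_def)
      finally show ?thesis .
    qed
    ultimately show ?thesis by simp
  qed
  show ?thesis
  proof (rule that[OF a0])
    show "e t = a + m" using W[of t] by (simp add: e_def)
    show "a < e r" for r using W[of t] W[of r] assms(2) by (simp add: e_def)
    show "(e has_real_derivative rate r * (e r - a)) (at r)" if "a0 < r" for r
      by (rule e'[OF that])
    show "(e T - a) * (width T * (\<kappa> T - \<kappa>\<^sub>2 T)) = m * (width t * (\<kappa> t - \<kappa>\<^sub>2 t)) * weight t T"
      if "t \<le> T" for T
    proof -
      have "exp (P T - P t) = weight t T"
        using integral_weight_exponent[OF less_imp_le[OF a0(2)] that] by (simp add: P_def weight_def)
      then show ?thesis using W[of T] by (simp add: e_def W_def [symmetric])
    qed
  qed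
qed

definition averages_in_segments :: "real \<Rightarrow> real \<Rightarrow> (real \<Rightarrow> real) \<Rightarrow> bool" where
  "averages_in_segments a b \<tau> \<longleftrightarrow> (\<forall>c d p q. a \<le> c \<longrightarrow> c < d \<longrightarrow> d \<le> b \<longrightarrow>
     ((\<lambda>s. x (\<tau> s)) has_integral (d - c) * p) {c..d} \<longrightarrow>
     ((\<lambda>s. y (\<tau> s)) has_integral (d - c) * q) {c..d} \<longrightarrow> (\<exists>r. segment_point r p q))"

text \<open>For \<open>\<theta> = 0\<close> the point is on the lower curve and a constant function does; otherwise the delivery
  curve occupies the fraction \<open>\<theta>\<close> of the interval and the value at \<open>t\<close> the rest. In the error bound the
  factor \<open>width T * (\<kappa> T - \<kappa>\<^sub>2 T)\<close> of the chord defect cancels against the mass at \<open>T\<close>.\<close>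

lemma exists_truncated_test_function:
  assumes "v < t" "t < T" and K_mono: "mono_on {T..} K"
    and "a < b" "0 \<le> \<theta>" "\<theta> \<le> 1"
  shows "\<exists>\<tau> u L. antimono \<tau> \<and> (\<forall>s. t \<le> \<tau> s \<and> \<tau> s \<le> u) \<and> averages_in_segments a b \<tau> \<and>
    ((\<lambda>s. x (\<tau> s)) has_integral (b - a) * (x t + \<theta> * width t)) {a..b} \<and>
    ((\<lambda>s. y (\<tau> s)) has_integral (b - a) * (y t + \<theta> * (\<kappa> t * width t))) {a..b} \<and>
    ((\<lambda>s. f (\<tau> s)) has_integral L) {a..b} \<and>
    \<bar>L - (b - a) * (f t + \<theta> * (contact_value t - f t))\<bar>
      \<le> \<theta> * (b - a) * (width t * (\<kappa> t - \<kappa>\<^sub>2 t)) * (weight t T * (\<beta> T - K T))"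
proof (cases "\<theta> = 0")
  case True
  have const: "((\<lambda>s. h) has_integral (d - c) * h) {c..d}" if "c \<le> d" for c d h :: real
    using has_integral_const_real[of h c d] that by simp
  have "averages_in_segments a b (\<lambda>_. t)"
    unfolding averages_in_segments_def
  proof (intro allI impI)
    fix c d p q :: real assume cd: "c < d" and pq: "((\<lambda>s. x t) has_integral (d - c) * p) {c..d}"
      "((\<lambda>s. y t) has_integral (d - c) * q) {c..d}"
    have "p = x t" "q = y t"
      using has_integral_unique[OF pq(1) const] has_integral_unique[OF pq(2) const] cd by auto
    then have "segment_point t p q"
      using X_s\<^sub>L[of t] tangency_iff by (simp add: segment_point_def)
    then show "\<exists>r. segment_point r p q" ..
  qed
  moreover have "antimono (\<lambda>_::real. t)" by (simp add: antimono_def)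
  ultimately show ?thesis
    using const[of a b] assms(4) True
    by (intro exI[of _ "\<lambda>_. t"] exI[of _ t] exI[of _ "(b - a) * f t"]) simp
next
  case False
  define m where "m = \<theta> * (b - a)"
  have m: "0 < m" using False assms by (simp add: m_def)
  obtain a0 e where e: "v < a0" "a0 < t" "e t = a + m" "\<And>r. a0 < r \<Longrightarrow> a < e r"
    "\<And>r. a0 < r \<Longrightarrow> (e has_real_derivative rate r * (e r - a)) (at r)"
    "\<And>T. t \<le> T \<Longrightarrow> (e T - a) * (width T * (\<kappa> T - \<kappa>\<^sub>2 T)) =
      m * (width t * (\<kappa> t - \<kappa>\<^sub>2 t)) * weight t T"
    by (rule obtain_delivery_mass[OF assms(1) m, where a = a]) (rule that; blast)
  interpret D: delivery x y x' \<kappa>\<^sub>2 \<kappa>\<^sub>2' X Y X' \<mu> \<mu>' s\<^sub>R s\<^sub>L a a0 t T e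
    by unfold_locales (use e assms in auto)
  have "\<theta> * (b - a) \<le> 1 * (b - a)" using assms by (intro mult_right_mono) auto
  then have "e t \<le> b" by (simp add: e(3) m_def)
  note total = D.integral_beyond_contact[OF this] D.integral_\<tau>_4[OF _ this]
  have f_delivery: "solves_delivery a0 f contact_value"
    using solves_delivery_contact_value e(1) by (simp add: solves_delivery_def)
  define L where "L = (e t - a) * contact_value t + (b - e t) * f t +
    (e T - a) * (D.\<alpha> * f D.U + (1 - D.\<alpha>) * f T - contact_value T)"
  show ?thesis
  proof (intro exI conjI allI)
    show "antimono D.\<tau>" "t \<le> D.\<tau> s" "D.\<tau> s \<le> D.U" for s
      using D.\<tau>_antimono D.\<tau>_bounds by auto
    show "averages_in_segments a b D.\<tau>"
      unfolding averages_in_segments_def using D.average_\<tau>_in_some_segment by blast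
    show "((\<lambda>s. x (D.\<tau> s)) has_integral (b - a) * (x t + \<theta> * width t)) {a..b}"
      using total(1) by (simp add: e(3) m_def width_def algebra_simps)
    show "((\<lambda>s. y (D.\<tau> s)) has_integral (b - a) * (y t + \<theta> * (\<kappa> t * width t))) {a..b}"
      using total(2) by (simp add: e(3) m_def Y_s\<^sub>L algebra_simps)
    show "((\<lambda>s. f (D.\<tau> s)) has_integral L) {a..b}"
      using total(3)[OF f_delivery] by (simp add: L_def)
    have "0 < e T - a" using e(4)[of T] e(2) assms by simp
    have "L - (b - a) * (f t + \<theta> * (contact_value t - f t))
        = (e T - a) * (D.\<alpha> * f D.U + (1 - D.\<alpha>) * f T - contact_value T)"
      by (simp add: L_def e(3) m_def algebra_simps)
    then have "\<bar>L - (b - a) * (f t + \<theta> * (contact_value t - f t))\<bar>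
        \<le> (e T - a) * (width T * (\<kappa> T - \<kappa>\<^sub>2 T) * (\<beta> T - K T))"
      using chord_defect[of T] assms \<open>0 < e T - a\<close>
      by (simp add: abs_mult D.\<alpha>_def D.U_def)
    also have "\<dots> = ((e T - a) * (width T * (\<kappa> T - \<kappa>\<^sub>2 T))) * (\<beta> T - K T)" by simp
    also have "\<dots> = \<theta> * (b - a) * (width t * (\<kappa> t - \<kappa>\<^sub>2 t)) * (weight t T * (\<beta> T - K T))"
      using e(6)[of T] assms by (simp add: m_def)
    finally show "\<bar>L - (b - a) * (f t + \<theta> * (contact_value t - f t))\<bar>
        \<le> \<theta> * (b - a) * (width t * (\<kappa> t - \<kappa>\<^sub>2 t)) * (weight t T * (\<beta> T - K T))" .
  qed
qed

lemma exists_optimizing_parameters: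
  assumes "v < t" and K_mono: "mono_on {N..} K"
    and decay: "((\<lambda>T. weight t T * (\<beta> T - K T)) \<longlongrightarrow> 0) at_top"
    and "a < b" "0 \<le> \<theta>" "\<theta> \<le> 1"
  shows "\<exists>(\<tau> :: nat \<Rightarrow> real \<Rightarrow> real) u L. (\<forall>n. antimono (\<tau> n) \<and> (\<forall>s. t \<le> \<tau> n s \<and> \<tau> n s \<le> u n) \<and>
    averages_in_segments a b (\<tau> n) \<and>
    ((\<lambda>s. x (\<tau> n s)) has_integral (b - a) * (x t + \<theta> * width t)) {a..b} \<and>
    ((\<lambda>s. y (\<tau> n s)) has_integral (b - a) * (y t + \<theta> * (\<kappa> t * width t))) {a..b} \<and>
    ((\<lambda>s. f (\<tau> n s)) has_integral L n) {a..b}) \<and>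
    L \<longlonglongrightarrow> (b - a) * (f t + \<theta> * (contact_value t - f t))"
proof -
  define T where "T n = max t N + 1 + real n" for n
  define l where "l = (b - a) * (f t + \<theta> * (contact_value t - f t))"
  define B where "B n = \<theta> * (b - a) * (width t * (\<kappa> t - \<kappa>\<^sub>2 t)) *
      (weight t (T n) * (\<beta> (T n) - K (T n)))" for n
  have "\<exists>\<tau> u L. antimono \<tau> \<and> (\<forall>s. t \<le> \<tau> s \<and> \<tau> s \<le> u) \<and> averages_in_segments a b \<tau> \<and>
    ((\<lambda>s. x (\<tau> s)) has_integral (b - a) * (x t + \<theta> * width t)) {a..b} \<and>
    ((\<lambda>s. y (\<tau> s)) has_integral (b - a) * (y t + \<theta> * (\<kappa> t * width t))) {a..b} \<and>
    ((\<lambda>s. f (\<tau> s)) has_integral L) {a..b} \<and> \<bar>L - l\<bar> \<le> B n" for n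
    unfolding l_def B_def
  proof (rule exists_truncated_test_function)
    show "mono_on {T n..} K" by (rule monotone_on_subset[OF K_mono]) (auto simp: T_def)
  qed (use assms in \<open>auto simp: T_def\<close>)
  then obtain \<tau> u L where *: "\<And>n. antimono (\<tau> n) \<and> (\<forall>s. t \<le> \<tau> n s \<and> \<tau> n s \<le> u n) \<and>
    averages_in_segments a b (\<tau> n) \<and>
    ((\<lambda>s. x (\<tau> n s)) has_integral (b - a) * (x t + \<theta> * width t)) {a..b} \<and>
    ((\<lambda>s. y (\<tau> n s)) has_integral (b - a) * (y t + \<theta> * (\<kappa> t * width t))) {a..b} \<and>
    ((\<lambda>s. f (\<tau> n s)) has_integral L n) {a..b} \<and> \<bar>L n - l\<bar> \<le> B n"
    by metis
  have "filterlim T at_top sequentially"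
    unfolding T_def by (intro filterlim_tendsto_add_at_top[OF tendsto_const] filterlim_real_sequentially)
  from filterlim_compose[OF decay this]
  have "(\<lambda>n. \<theta> * (b - a) * (width t * (\<kappa> t - \<kappa>\<^sub>2 t)) * (weight t (T n) * (\<beta> (T n) - K (T n)))) \<longlonglongrightarrow>
      \<theta> * (b - a) * (width t * (\<kappa> t - \<kappa>\<^sub>2 t)) * 0"
    by (rule tendsto_mult_left)
  then have "B \<longlonglongrightarrow> 0" by (simp add: B_def[abs_def])
  then have "(\<lambda>n. L n - l) \<longlonglongrightarrow> 0"
    by (rule Lim_null_comparison[rotated]) (use * in \<open>simp add: eventuallyI\<close>)
  then have "L \<longlonglongrightarrow> l" by (simp add: LIM_zero_iff)
  then show ?thesis using * unfolding l_def by blast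
qed

end

section \<open>Averages over intervals\<close>

lemma obtain_interval_bounds:
  assumes "proper_interval J"
  obtains c d where "c < d" and "{c<..<d} \<subseteq> J" and "J \<subseteq> {c..d}"
proof -
  have J: "is_interval J" "bounded J" "interior J \<noteq> {}" using assms by (auto simp: proper_interval_def)
  then have ne: "J \<noteq> {}" by auto
  have bdd: "bdd_above J" "bdd_below J" using J(2) by (simp_all add: bounded_imp_bdd_above bounded_imp_bdd_below)
  have sub: "J \<subseteq> {Inf J..Sup J}" using bdd by (auto intro: cInf_lower cSup_upper)
  have sup: "{Inf J<..<Sup J} \<subseteq> J"
  proof
    fix s assume "s \<in> {Inf J<..<Sup J}"
    then obtain l u where "l \<in> J" "l < s" "u \<in> J" "s < u"
      using cInf_less_iff[OF ne bdd(2)] less_cSup_iff[OF ne bdd(1)] by auto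
    then show "s \<in> J" using J(1) unfolding is_interval_1 by (meson less_imp_le)
  qed
  have "\<not> Sup J \<le> Inf J"
  proof
    assume "Sup J \<le> Inf J"
    then have "J \<subseteq> {Inf J}" using sub by auto
    then have "interior J \<subseteq> interior {Inf J}" by (rule interior_mono)
    then show False using J(3) by simp
  qed
  then show ?thesis using that[of "Inf J" "Sup J"] sub sup by auto
qed

text \<open>The intervals in the definition of the test functions may or may not contain their endpoints.\<close>

lemma has_integral_Icc_iff:
  fixes h :: "real \<Rightarrow> 'a::banach"
  assumes "{c<..<d} \<subseteq> J" and "J \<subseteq> {c..d}"
  shows "(h has_integral i) J \<longleftrightarrow> (h has_integral i) {c..d}"
proof (rule has_integral_spike_set_eq)
  have "{s \<in> J - {c..d}. h s \<noteq> 0} = {}" using assms by auto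
  then show "negligible {s \<in> J - {c..d}. h s \<noteq> 0}" by (simp only: negligible_empty)
  have "{s \<in> {c..d} - J. h s \<noteq> 0} \<subseteq> {c, d}" using assms by force
  then show "negligible {s \<in> {c..d} - J. h s \<noteq> 0}"
    by (rule negligible_subset[rotated]) simp
qed

lemma measure_interval:
  assumes "{c<..<d} \<subseteq> J" and "J \<subseteq> {c..d}" and "c \<le> d"
  shows "J \<in> lmeasurable" and "measure lebesgue J = d - c"
proof -
  have "((\<lambda>_. 1 :: real) has_integral d - c) J"
    using has_integral_Icc_iff[OF assms(1,2)] has_integral_const_real[of "1::real" c d] assms(3) by auto
  then show "J \<in> lmeasurable" "measure lebesgue J = d - c"
    by (auto simp: lmeasurable_iff_integrable_on lmeasure_integral integral_unique has_integral_integrable)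
qed

lemma average_has_integral:
  fixes \<phi> :: "real \<Rightarrow> 'a::euclidean_space"
  assumes J: "{c<..<d} \<subseteq> J" "J \<subseteq> {c..d}" "c < d" and "set_integrable lebesgue J \<phi>"
  shows "(\<phi> has_integral (d - c) *\<^sub>R average \<phi> J) {c..d}"
proof -
  have "(\<phi> has_integral (LINT s:J|lebesgue. \<phi> s)) J"
    using set_lebesgue_integral_eq_integral[OF assms(4)] by (simp add: has_integral_iff)
  then show ?thesis
    using has_integral_Icc_iff[OF J(1,2), of \<phi>] measure_interval[OF J(1,2)] J(3) by (simp add: average_def)
qed

lemma set_integrable_of_monotone_parameter:
  fixes \<tau> :: "real \<Rightarrow> real" and h :: "real \<Rightarrow> 'a::euclidean_space"
  assumes "antimono \<tau>" and "\<And>s. t \<le> \<tau> s \<and> \<tau> s \<le> u" and "continuous_on UNIV h"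
    and "J \<in> lmeasurable"
  shows "set_integrable lebesgue J (\<lambda>s. h (\<tau> s))"
proof -
  have "mono (\<lambda>s. - \<tau> s)" using assms(1) by (auto simp: antimono_def mono_def)
  then have "(\<lambda>s. - \<tau> s) \<in> borel_measurable borel" using borel_measurable_mono[of "\<lambda>s. - \<tau> s"] by simp
  then have "(\<lambda>s. - (- \<tau> s)) \<in> borel_measurable borel" by (rule borel_measurable_uminus)
  then have "\<tau> \<in> borel_measurable borel" by simp
  then have "(\<lambda>s. h (\<tau> s)) \<in> borel_measurable borel"
    using borel_measurable_continuous_onI[OF assms(3)] by measurable
  then have meas: "(\<lambda>s. h (\<tau> s)) \<in> borel_measurable (lebesgue_on J)"
    by (intro measurable_restrict_space1 measurable_completion) simp
  have "compact (h ` {t..u})"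
    by (intro compact_continuous_image continuous_on_subset[OF assms(3)]) auto
  then obtain M where M: "\<And>z. z \<in> h ` {t..u} \<Longrightarrow> norm z \<le> M"
    using compact_imp_bounded bounded_iff by metis
  show ?thesis
  proof (rule measurable_bounded_by_integrable_imp_absolutely_integrable[OF meas])
    show "(\<lambda>_. M) integrable_on J" using assms(4) by (simp add: integrable_on_const)
    show "norm (h (\<tau> s)) \<le> M" for s using M assms(2) by auto
  qed (use assms(4) in auto)
qed

section \<open>Admissible families\<close>

lemma C31_smooth_derivs:
  assumes "C31_smooth E h" and "\<epsilon> \<in> E"
  shows "(h \<epsilon> has_real_derivative deriv (h \<epsilon>) t) (at t)"
    and "(deriv (h \<epsilon>) has_real_derivative deriv (deriv (h \<epsilon>)) t) (at t)"
    and "isCont (deriv (deriv (h \<epsilon>))) t"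
proof -
  obtain D :: "nat \<Rightarrow> nat \<Rightarrow> real \<Rightarrow> real \<Rightarrow> real" where D0: "\<forall>\<epsilon>\<in>E. \<forall>t. D 0 0 \<epsilon> t = h \<epsilon> t"
    and D: "\<forall>i<3. \<forall>j\<le>1. \<forall>\<epsilon>\<in>E. \<forall>t. (D i j \<epsilon> has_real_derivative D (Suc i) j \<epsilon> t) (at t)"
    using assms(1) unfolding C31_smooth_def by (elim exE conjE) (rule that)
  have d: "(D i 0 \<epsilon> has_real_derivative D (Suc i) 0 \<epsilon> t) (at t)" if "i < 3" for i t
    using D assms(2) that by auto
  have "D 0 0 \<epsilon> = h \<epsilon>" using D0 assms(2) by auto
  then have 0: "(h \<epsilon> has_real_derivative D 1 0 \<epsilon> t) (at t)" for t using d[of 0 t] by simp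
  then have h1: "deriv (h \<epsilon>) = D 1 0 \<epsilon>" by (simp add: DERIV_imp_deriv fun_eq_iff)
  have 1: "(D 1 0 \<epsilon> has_real_derivative D 2 0 \<epsilon> t) (at t)" for t
    using d[of 1 t] by (simp add: numeral_2_eq_2)
  then have h2: "deriv (deriv (h \<epsilon>)) = D 2 0 \<epsilon>" by (simp add: h1 DERIV_imp_deriv fun_eq_iff)
  show "(h \<epsilon> has_real_derivative deriv (h \<epsilon>) t) (at t)" using 0 h1 by simp
  show "(deriv (h \<epsilon>) has_real_derivative deriv (deriv (h \<epsilon>)) t) (at t)" using 1 by (simp only: h1 h2[unfolded h1])
  show "isCont (deriv (deriv (h \<epsilon>))) t" using DERIV_isCont[OF d[of 2 t]] by (simp add: h2)
qed

definition curve_slope :: "family \<Rightarrow> real \<Rightarrow> real \<Rightarrow> real" where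
  "curve_slope G \<epsilon> t = deriv (g2 G \<epsilon>) t / deriv (g1 G \<epsilon>) t"

lemma kappa2_eq: "kappa2 G = curve_slope G 0"
  by (simp add: fun_eq_iff kappa2_def curve_slope_def)

locale admissible =
  fixes \<epsilon>max :: ereal and G :: family and \<epsilon> :: real
  assumes adm: "admissible_family \<epsilon>max G" and pos: "0 < \<epsilon>" and less: "ereal \<epsilon> < \<epsilon>max"
begin

lemma index: "0 \<in> index_range \<epsilon>max" "\<epsilon> \<in> index_range \<epsilon>max" "\<epsilon> \<in> index_range \<epsilon>max - {0}"
proof -
  have "0 < \<epsilon>max" using adm by (simp add: admissible_family_def)
  then show "0 \<in> index_range \<epsilon>max" by (simp add: index_range_def zero_ereal_def [symmetric])
  show "\<epsilon> \<in> index_range \<epsilon>max" "\<epsilon> \<in> index_range \<epsilon>max - {0}"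
    using pos less by (simp_all add: index_range_def)
qed

lemma smooth: "C31_smooth (index_range \<epsilon>max) (g1 G)" "C31_smooth (index_range \<epsilon>max) (g2 G)"
  using adm by (simp_all add: admissible_family_def)

lemma curvature:
  assumes "\<delta> \<in> index_range \<epsilon>max"
  shows "0 < deriv (g1 G \<delta>) t"
    and "0 < deriv (deriv (g2 G \<delta>)) t * deriv (g1 G \<delta>) t - deriv (g2 G \<delta>) t * deriv (deriv (g1 G \<delta>)) t"
  using adm assms by (simp_all add: admissible_family_def)

lemma slope_deriv:
  assumes "\<delta> \<in> index_range \<epsilon>max"
  shows "(curve_slope G \<delta> has_real_derivative
    (deriv (deriv (g2 G \<delta>)) t * deriv (g1 G \<delta>) t - deriv (g2 G \<delta>) t * deriv (deriv (g1 G \<delta>)) t)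
    / (deriv (g1 G \<delta>) t * deriv (g1 G \<delta>) t)) (at t)"
  unfolding curve_slope_def[abs_def]
  by (rule DERIV_divide C31_smooth_derivs[OF smooth(1) assms] C31_smooth_derivs[OF smooth(2) assms])+
    (use curvature(1)[OF assms, of t] in simp)

lemma convex_curve_family:
  assumes "\<delta> \<in> index_range \<epsilon>max"
  shows "convex_curve (g1 G \<delta>) (g2 G \<delta>) (deriv (g1 G \<delta>)) (curve_slope G \<delta>) (deriv (curve_slope G \<delta>))"
proof
  note d = slope_deriv[OF assms] and c = curvature[OF assms]
  show "(g1 G \<delta> has_real_derivative deriv (g1 G \<delta>) t) (at t)" for t
    by (rule C31_smooth_derivs[OF smooth(1) assms])
  show "0 < deriv (g1 G \<delta>) t" for t by (rule c)
  show "(g2 G \<delta> has_real_derivative curve_slope G \<delta> t * deriv (g1 G \<delta>) t) (at t)" for t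
    using C31_smooth_derivs(1)[OF smooth(2) assms, of t] c(1)[of t] by (simp add: curve_slope_def)
  show "(curve_slope G \<delta> has_real_derivative deriv (curve_slope G \<delta>) t) (at t)" for t
    using d[of t] DERIV_imp_deriv[OF d[of t]] by simp
  show "0 < deriv (curve_slope G \<delta>) t" for t
    unfolding DERIV_imp_deriv[OF d] using c[of t] by simp
qed

sublocale lower: convex_curve "g1 G 0" "g2 G 0" "deriv (g1 G 0)" "curve_slope G 0" "deriv (curve_slope G 0)"
  by (rule convex_curve_family[OF index(1)])

sublocale upper: convex_curve "g1 G \<epsilon>" "g2 G \<epsilon>" "deriv (g1 G \<epsilon>)" "curve_slope G \<epsilon>" "deriv (curve_slope G \<epsilon>)"
  by (rule convex_curve_family[OF index(2)])

lemma tangent_line_iff: "p \<in> tangent_line (G \<epsilon>) s \<longleftrightarrow> upper.tangent_at s (fst p) = snd p"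
proof -
  have G: "G \<epsilon> = (\<lambda>t. (g1 G \<epsilon> t, g2 G \<epsilon> t))" by (simp add: fun_eq_iff g1_def g2_def)
  have "(G \<epsilon> has_vector_derivative (deriv (g1 G \<epsilon>) s, curve_slope G \<epsilon> s * deriv (g1 G \<epsilon>) s)) (at s)"
    by (subst G) (intro has_vector_derivative_Pair
      upper.x_deriv[unfolded has_real_derivative_iff_has_vector_derivative]
      upper.y_deriv[unfolded has_real_derivative_iff_has_vector_derivative])
  then have v: "vector_derivative (G \<epsilon>) (at s) =
      (deriv (g1 G \<epsilon>) s, curve_slope G \<epsilon> s * deriv (g1 G \<epsilon>) s)"
    by (rule vector_derivative_at)
  have "p \<in> tangent_line (G \<epsilon>) s \<longleftrightarrow> (\<exists>c. fst p = g1 G \<epsilon> s + c * deriv (g1 G \<epsilon>) s \<and>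
      snd p = g2 G \<epsilon> s + c * (curve_slope G \<epsilon> s * deriv (g1 G \<epsilon>) s))"
    by (auto simp: tangent_line_def v prod_eq_iff g1_def g2_def)
  also have "\<dots> \<longleftrightarrow> upper.tangent_at s (fst p) = snd p"
  proof
    assume "upper.tangent_at s (fst p) = snd p"
    then show "\<exists>c. fst p = g1 G \<epsilon> s + c * deriv (g1 G \<epsilon>) s \<and>
      snd p = g2 G \<epsilon> s + c * (curve_slope G \<epsilon> s * deriv (g1 G \<epsilon>) s)"
      using upper.x'_pos[of s]
      by (intro exI[of _ "(fst p - g1 G \<epsilon> s) / deriv (g1 G \<epsilon>) s"])
        (auto simp: upper.tangent_at_def mult.commute)
  qed (auto simp: upper.tangent_at_def)
  finally show ?thesis .
qed

lemma G_0_eq_iff: "G 0 t = G 0 u \<longleftrightarrow> t = u"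
  using lower.x_eq_iff by (metis g1_def)

lemma tangency_params_iff:
  "s \<in> tangency_params G \<epsilon> t \<longleftrightarrow> upper.tangent_at s (g1 G 0 t) = g2 G 0 t"
  by (simp add: tangency_params_def tangent_line_iff g1_def g2_def)

lemma tangency_params_eq:
  "tangency_params G \<epsilon> t = {s_R G \<epsilon> t, s_L G \<epsilon> t}" "s_R G \<epsilon> t < s_L G \<epsilon> t"
proof -
  have "card (tangency_params G \<epsilon> t) = 2"
    using adm index(3) by (simp add: admissible_family_def)
  then obtain a b where ab: "tangency_params G \<epsilon> t = {a, b}" "a \<noteq> b"
    by (auto simp: card_2_iff)
  then show "tangency_params G \<epsilon> t = {s_R G \<epsilon> t, s_L G \<epsilon> t}" "s_R G \<epsilon> t < s_L G \<epsilon> t"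
    by (auto simp: s_R_def s_L_def min_def max_def)
qed

text \<open>Points vertically above the upper curve belong to \<open>Xi G \<epsilon>\<close>, hence to \<open>Xi G 0\<close>; this puts the same
  abscissa on the lower curve, at no greater height. Equality is excluded because the lower curve
  avoids the closure of \<open>Xi G \<epsilon>\<close>.\<close>

lemma above_lower_curve: "\<exists>t. g1 G 0 t = g1 G \<epsilon> s \<and> g2 G 0 t < g2 G \<epsilon> s"
proof -
  have sub: "Xi G \<epsilon> \<subseteq> Xi G 0" and out: "\<And>t. G 0 t \<notin> closure (Xi G \<epsilon>)"
    using adm index(1,2) pos unfolding admissible_family_def by blast+
  have below: "\<exists>t. g1 G 0 t = g1 G \<epsilon> s \<and> g2 G 0 t < g2 G \<epsilon> s + d" if "0 < d" for d
  proof -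
    have "(g1 G \<epsilon> s, g2 G \<epsilon> s + d) \<in> Xi G \<epsilon>" using that by (force simp: Xi_def)
    then have "(g1 G \<epsilon> s, g2 G \<epsilon> s + d) \<in> Xi G 0" using sub by blast
    then show ?thesis by (auto simp: Xi_def)
  qed
  obtain t where t: "g1 G 0 t = g1 G \<epsilon> s" using below[of 1] by auto
  have "g2 G 0 t \<le> g2 G \<epsilon> s"
  proof (rule field_le_epsilon)
    fix d :: real assume "0 < d"
    then obtain u where "g1 G 0 u = g1 G \<epsilon> s" "g2 G 0 u < g2 G \<epsilon> s + d" using below by blast
    then show "g2 G 0 t \<le> g2 G \<epsilon> s + d" using t lower.x_eq_iff by (metis less_imp_le)
  qed
  moreover have "g2 G 0 t \<noteq> g2 G \<epsilon> s"
  proof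
    assume eq: "g2 G 0 t = g2 G \<epsilon> s"
    have "G 0 t \<in> closure (Xi G \<epsilon>)"
      unfolding closure_approachable
    proof (intro allI impI)
      fix d :: real assume "0 < d"
      then have "(g1 G \<epsilon> s, g2 G \<epsilon> s + d / 2) \<in> Xi G \<epsilon>" by (force simp: Xi_def)
      moreover have "G 0 t = (g1 G \<epsilon> s, g2 G \<epsilon> s)" using t eq by (simp add: g1_def g2_def prod_eq_iff)
      then have "dist (g1 G \<epsilon> s, g2 G \<epsilon> s + d / 2) (G 0 t) < d"
        using \<open>0 < d\<close> by (simp add: dist_Pair_Pair dist_real_def)
      ultimately show "\<exists>z\<in>Xi G \<epsilon>. dist z (G 0 t) < d" by blast
    qed
    then show False using out by blast
  qed
  ultimately show ?thesis using t by force
qed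

sublocale curve_pair "g1 G 0" "g2 G 0" "deriv (g1 G 0)" "curve_slope G 0" "deriv (curve_slope G 0)"
  "g1 G \<epsilon>" "g2 G \<epsilon>" "deriv (g1 G \<epsilon>)" "curve_slope G \<epsilon>" "deriv (curve_slope G \<epsilon>)"
  "s_R G \<epsilon>" "s_L G \<epsilon>"
proof
  show "\<exists>t. g1 G 0 t = g1 G \<epsilon> s \<and> g2 G 0 t < g2 G \<epsilon> s" for s by (rule above_lower_curve)
  show "s_R G \<epsilon> t < s_L G \<epsilon> t" for t by (rule tangency_params_eq)
  show "upper.tangent_at s (g1 G 0 t) = g2 G 0 t \<longleftrightarrow> s = s_R G \<epsilon> t \<or> s = s_L G \<epsilon> t" for t s
    using tangency_params_iff[of s t] tangency_params_eq(1)[of t] by auto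
  show "\<exists>u. u \<noteq> t \<and> upper.tangent_at s (g1 G 0 u) = g2 G 0 u"
    if "upper.tangent_at s (g1 G 0 t) = g2 G 0 t" for t s
  proof -
    have "s \<in> tangency_params G \<epsilon> t" using that tangency_params_iff by simp
    then have "card (tangent_line (G \<epsilon>) s \<inter> range (G 0)) = 2"
      using adm index(3) unfolding admissible_family_def by blast
    then obtain z where "z \<in> tangent_line (G \<epsilon>) s \<inter> range (G 0)" "z \<noteq> G 0 t"
      unfolding card_2_iff by (metis insertCI)
    then obtain u where "G 0 u \<in> tangent_line (G \<epsilon>) s" "u \<noteq> t" by auto
    then show ?thesis by (auto simp: tangent_line_iff g1_def g2_def)
  qed
  have "isCont (deriv (curve_slope G 0)) t" for t
  proof -
    note c1 = C31_smooth_derivs[OF smooth(1) index(1)] and c2 = C31_smooth_derivs[OF smooth(2) index(1)]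
    show ?thesis
      unfolding DERIV_imp_deriv[OF slope_deriv[OF index(1)], abs_def]
      by (intro continuous_intros c1(3) c2(3) DERIV_isCont[OF c1(2)] DERIV_isCont[OF c2(2)])
        (use curvature(1)[OF index(1), of t] in simp)
  qed
  then show "continuous_on UNIV (deriv (curve_slope G 0))"
    by (simp add: continuous_at_imp_continuous_on)
qed

lemma kappa_L_eq: "kappa_L G \<epsilon> t = \<kappa> t"
  using width_pos[of t] Y_s\<^sub>L[of t]
  by (simp add: kappa_L_def slope_def w_L_def width_def g1_def g2_def)

lemma w_L_eq: "w_L G \<epsilon> t = (g1 G 0 t + width t, g2 G 0 t + \<kappa> t * width t)"
  using Y_s\<^sub>L[of t] by (simp add: w_L_def width_def g1_def g2_def prod_eq_iff)

lemma G_0: "G 0 t = (g1 G 0 t, g2 G 0 t)"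
  by (simp add: g1_def g2_def)

lemma S_L_obtain:
  assumes "z \<in> S_L G \<epsilon> t"
  obtains \<theta> where "0 \<le> \<theta>" "\<theta> \<le> 1" "z = (g1 G 0 t + \<theta> * width t, g2 G 0 t + \<theta> * (\<kappa> t * width t))"
proof -
  obtain \<theta> where "0 \<le> \<theta>" "\<theta> \<le> 1" "z = (1 - \<theta>) *\<^sub>R G 0 t + \<theta> *\<^sub>R w_L G \<epsilon> t"
    using assms by (auto simp: S_L_def in_segment)
  then show ?thesis using that[of \<theta>] by (simp add: w_L_eq G_0 algebra_simps)
qed

text \<open>The left tangent segment is a side of its curvilinear triangle.\<close>

lemma segment_point_in_Omega:
  assumes "segment_point t p q"
  shows "(p, q) \<in> Omega G \<epsilon>"
proof -
  define \<theta> where "\<theta> = (p - g1 G 0 t) / width t"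
  have p: "p = g1 G 0 t + \<theta> * width t" using width_pos[of t] by (simp add: \<theta>_def)
  have "g1 G 0 t \<le> p" "p \<le> g1 G 0 t + width t"
    using assms by (simp_all add: segment_point_def width_def)
  then have \<theta>: "0 \<le> \<theta>" "\<theta> \<le> 1" using width_pos[of t] by (simp_all add: \<theta>_def)
  have "q = g2 G 0 t + height (s_L G \<epsilon> t) t + \<kappa> t * (p - g1 G 0 t)"
    using assms by (simp add: segment_point_def height_def upper.tangent_at_def \<kappa>_def algebra_simps)
  then have q: "q = g2 G 0 t + \<theta> * (\<kappa> t * width t)" by (simp add: p)
  have "(p, q) = (1 - \<theta>) *\<^sub>R G 0 t + \<theta> *\<^sub>R w_L G \<epsilon> t"
    by (simp add: p q w_L_eq G_0 algebra_simps)
  then have "(p, q) \<in> S_L G \<epsilon> t" using \<theta> unfolding S_L_def in_segment by blast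
  then show ?thesis
    by (auto simp: Omega_def curvilinear_triangle_def triangle_sides_def)
qed

end

locale admissible_candidate = admissible +
  fixes f :: "real \<Rightarrow> real" and v :: real and B :: "plane \<Rightarrow> real"
  assumes regular: "regular_fun G f" and standard: "standard_candidate G \<epsilon> f v B"
begin

lemma tail:
  assumes "v < t"
  shows "has_stieltjes_integral_at_top (exp_weight G \<epsilon> t) (K_ratio G f) t (beta_tail G \<epsilon> f t)"
    and "0 < beta_tail G \<epsilon> f t"
    and "(beta2 G \<epsilon> f has_real_derivative
      deriv (curve_slope G 0) t / (\<kappa> t - curve_slope G 0 t) * beta_tail G \<epsilon> f t) (at t)"
proof -
  obtain z where "has_stieltjes_integral_at_top (exp_weight G \<epsilon> t) (K_ratio G f) t z"
    using standard assms unfolding standard_candidate_def by blast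
  then show "has_stieltjes_integral_at_top (exp_weight G \<epsilon> t) (K_ratio G f) t (beta_tail G \<epsilon> f t)"
    by (simp add: beta_tail_def stieltjes_integral_at_top_eq)
  define c where "c = \<kappa> t - curve_slope G 0 t"
  have c: "0 < c" using \<kappa>_greater[of t] by (simp add: c_def)
  have "curve_slope G 0 t - \<kappa> t = - c" by (simp add: c_def)
  then have eq: "beta2' G \<epsilon> f t = deriv (curve_slope G 0) t / c * beta_tail G \<epsilon> f t"
    by (simp add: beta2'_def kappa2_eq kappa_L_eq)
  have "0 < beta2' G \<epsilon> f t" using standard assms by (simp add: standard_candidate_def)
  then show "0 < beta_tail G \<epsilon> f t"
    using c lower.k'_pos[of t] by (simp add: eq zero_less_mult_iff zero_less_divide_iff)
  show "(beta2 G \<epsilon> f has_real_derivative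
      deriv (curve_slope G 0) t / (\<kappa> t - curve_slope G 0 t) * beta_tail G \<epsilon> f t) (at t)"
    using standard assms unfolding standard_candidate_def eq [unfolded c_def, symmetric] by blast
qed

sublocale candidate "g1 G 0" "g2 G 0" "deriv (g1 G 0)" "curve_slope G 0" "deriv (curve_slope G 0)"
  "g1 G \<epsilon>" "g2 G \<epsilon>" "deriv (g1 G \<epsilon>)" "curve_slope G \<epsilon>" "deriv (curve_slope G \<epsilon>)"
  "s_R G \<epsilon>" "s_L G \<epsilon>" f "kappa3 G f" "K_ratio G f" "beta2 G \<epsilon> f" v
proof
  have f': "(f has_real_derivative deriv f t) (at t)" for t
    using regular by (simp add: regular_fun_def DERIV_deriv_iff_real_differentiable)
  then show "(f has_real_derivative kappa3 G f t * deriv (g1 G 0) t) (at t)" for t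
    using lower.x'_pos[of t] by (simp add: kappa3_def)
  show "(kappa3 G f has_real_derivative K_ratio G f t * deriv (curve_slope G 0) t) (at t)" for t
  proof -
    have "deriv f differentiable at t" using regular by (simp add: regular_fun_def)
    moreover have "deriv (g1 G 0) differentiable at t"
      using C31_smooth_derivs(2)[OF smooth(1) index(1)] real_differentiable_def by blast
    ultimately have "kappa3 G f differentiable at t"
      using lower.x'_pos[of t] unfolding kappa3_def[abs_def]
      by (intro differentiable_divide) auto
    then have "(kappa3 G f has_real_derivative deriv (kappa3 G f) t) (at t)"
      by (simp add: DERIV_deriv_iff_real_differentiable)
    then show ?thesis using lower.k'_pos[of t] by (simp add: K_ratio_def kappa2_eq)
  qed
  show "(beta2 G \<epsilon> f has_real_derivative
      deriv (curve_slope G 0) t / (\<kappa> t - curve_slope G 0 t) * (beta2 G \<epsilon> f t - K_ratio G f t)) (at t)"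
    if "v < t" for t
    using tail(3)[OF that] by (simp add: beta2_def)
  show "K_ratio G f t < beta2 G \<epsilon> f t" if "v < t" for t
    using tail(2)[OF that] by (simp add: beta2_def)
qed

lemma exp_weight_eq: "exp_weight G \<epsilon> t = weight t"
  by (simp add: fun_eq_iff exp_weight_def weight_def kappa2_eq kappa_L_eq)

text \<open>Beyond the last breakpoint \<open>K_ratio\<close> is monotone. If it were non-increasing there, the integral of the
  positive weight against it could not be positive.\<close>

lemma K_eventually_mono: "\<exists>N. mono_on {N..} (K_ratio G f)"
proof -
  obtain P where P: "finite P"
    "\<And>J. is_interval J \<Longrightarrow> J \<inter> P = {} \<Longrightarrow> mono_on J (K_ratio G f) \<or> antimono_on J (K_ratio G f)"
    using regular by (auto simp: regular_fun_def piecewise_monotone_def)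
  \<comment> \<open>The point \<open>v\<close> enters the maximum because the tail is only known to be positive to the right of \<open>v\<close>.\<close>
  define N where "N = Max (insert v P) + 1"
  have N: "p < N" if "p \<in> insert v P" for p
  proof -
    have "p \<le> Max (insert v P)" by (rule Max_ge) (use P(1) that in auto)
    then show ?thesis by (simp add: N_def)
  qed
  have "\<not> antimono_on {N..} (K_ratio G f)"
  proof
    assume anti: "antimono_on {N..} (K_ratio G f)"
    have "beta_tail G \<epsilon> f N \<le> 0"
      by (rule stieltjes_integral_at_top_nonpos[OF tail(1) anti]) (use N in \<open>simp_all add: exp_weight_def\<close>)
    then show False using tail(2)[of N] N by simp
  qed
  moreover have "{N..} \<inter> P = {}" using N by force
  ultimately show ?thesis using P(2)[of "{N..}"] by (auto simp: is_interval_ci)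
qed

lemma weighted_tail_tendsto_0:
  assumes "v < t"
  shows "((\<lambda>T. weight t T * (beta2 G \<epsilon> f T - K_ratio G f T)) \<longlongrightarrow> 0) at_top"
proof -
  have "((\<lambda>T. weight t T * beta_tail G \<epsilon> f T) \<longlongrightarrow> 0) at_top"
  proof (rule stieltjes_tail_tendsto_0)
    show "has_stieltjes_integral_at_top (weight T) (K_ratio G f) T (beta_tail G \<epsilon> f T)" if "t \<le> T" for T
      using tail(1)[of T] assms that by (simp add: exp_weight_eq)
  qed (rule weight_mult)
  then show ?thesis by (simp add: beta2_def)
qed

lemma B_on_segment:
  assumes "v < t" and z: "z = (g1 G 0 t + \<theta> * width t, g2 G 0 t + \<theta> * (\<kappa> t * width t))"
    and "z \<in> S_L G \<epsilon> t"
  shows "B z = f t + \<theta> * (contact_value t - f t)"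
proof -
  have "B z = f t + (fst z - g1 G 0 t) *
      (kappa3 G f t + (kappa_L G \<epsilon> t - kappa2 G t) * beta2 G \<epsilon> f t)"
    using standard assms(1,3) unfolding standard_candidate_def by blast
  then show ?thesis by (simp add: z contact_value_def kappa_L_eq kappa2_eq)
qed

lemma exists_optimizing_sequence:
  assumes "proper_interval I" and "z \<in> Omega_L G \<epsilon> v"
  shows "\<exists>\<phi> :: nat \<Rightarrow> real \<Rightarrow> plane.
    optimizing_sequence (Omega G \<epsilon>) (fixed_boundary G) (boundary_fun G f) I B z \<phi> \<and>
    (\<forall>n. nonincreasing_on G I (\<phi> n)) \<and>
    (\<forall>n. \<forall>s\<in>I. boundary_le G (G 0 v) (\<phi> n s))"
proof -
  obtain t where t: "v < t" "z \<in> S_L G \<epsilon> t" using assms(2) by (auto simp: Omega_L_def)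
  obtain \<theta> where \<theta>: "0 \<le> \<theta>" "\<theta> \<le> 1"
    and z: "z = (g1 G 0 t + \<theta> * width t, g2 G 0 t + \<theta> * (\<kappa> t * width t))"
    using S_L_obtain[OF t(2)] by blast
  have fst_z: "fst z = g1 G 0 t + \<theta> * width t"
    and snd_z: "snd z = g2 G 0 t + \<theta> * (\<kappa> t * width t)" by (simp_all add: z)
  have Bz: "B z = f t + \<theta> * (contact_value t - f t)" by (rule B_on_segment[OF t(1) z t(2)])
  obtain a b where I: "a < b" "{a<..<b} \<subseteq> I" "I \<subseteq> {a..b}"
    using obtain_interval_bounds[OF assms(1)] by blast
  obtain N where N: "mono_on {N..} (K_ratio G f)" using K_eventually_mono by blast
  obtain \<tau> u L where H: "\<forall>n. antimono (\<tau> n) \<and> (\<forall>s. t \<le> \<tau> n s \<and> \<tau> n s \<le> u n) \<and>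
      averages_in_segments a b (\<tau> n) \<and>
      ((\<lambda>s. g1 G 0 (\<tau> n s)) has_integral (b - a) * fst z) {a..b} \<and>
      ((\<lambda>s. g2 G 0 (\<tau> n s)) has_integral (b - a) * snd z) {a..b} \<and>
      ((\<lambda>s. f (\<tau> n s)) has_integral L n) {a..b}"
    and lim: "L \<longlonglongrightarrow> (b - a) * B z"
    using exists_optimizing_parameters[OF t(1) N weighted_tail_tendsto_0[OF t(1)] I(1) \<theta>,
        folded Bz fst_z snd_z] by (elim exE conjE) (rule that)
  have *: "\<And>n. antimono (\<tau> n)" "\<And>n s. t \<le> \<tau> n s \<and> \<tau> n s \<le> u n"
    "\<And>n. averages_in_segments a b (\<tau> n)"
    "\<And>n. ((\<lambda>s. g1 G 0 (\<tau> n s)) has_integral (b - a) * fst z) {a..b}"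
    "\<And>n. ((\<lambda>s. g2 G 0 (\<tau> n s)) has_integral (b - a) * snd z) {a..b}"
    "\<And>n. ((\<lambda>s. f (\<tau> n s)) has_integral L n) {a..b}"
    using H by blast+
  define \<phi> where "\<phi> n s = G 0 (\<tau> n s)" for n :: nat and s :: real
  have cont_G: "continuous_on UNIV (G 0)"
    unfolding G_0[abs_def] by (intro continuous_intros lower.continuous_x lower.continuous_y)
  have cont_f: "continuous_on UNIV f"
    by (meson DERIV_isCont continuous_at_imp_continuous_on f_deriv)
  have bf: "boundary_fun G f \<circ> \<phi> n = (\<lambda>s. f (\<tau> n s))" for n
  proof -
    have "inj (G 0)" by (simp add: inj_def G_0_eq_iff)
    then show ?thesis by (simp add: fun_eq_iff boundary_fun_def \<phi>_def)
  qed
  have int_\<phi>: "set_integrable lebesgue J (\<phi> n)" if "J \<in> lmeasurable" for J n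
    unfolding \<phi>_def[abs_def] by (rule set_integrable_of_monotone_parameter[OF *(1,2) cont_G that])
  have int_f: "set_integrable lebesgue I (\<lambda>s. f (\<tau> n s))" for n
    by (rule set_integrable_of_monotone_parameter[OF *(1,2) cont_f measure_interval(1)[OF I(2,3)]])
      (use I in simp)
  have avg: "((\<lambda>s. g1 G 0 (\<tau> n s)) has_integral (d - c) * fst (average (\<phi> n) J)) {c..d}"
    "((\<lambda>s. g2 G 0 (\<tau> n s)) has_integral (d - c) * snd (average (\<phi> n) J)) {c..d}"
    if J: "{c<..<d} \<subseteq> J" "J \<subseteq> {c..d}" "c < d" for J n c d
  proof -
    have h: "(\<phi> n has_integral (d - c) *\<^sub>R average (\<phi> n) J) {c..d}"
      by (rule average_has_integral[OF J int_\<phi>]) (use measure_interval(1)[OF J(1,2)] J(3) in simp)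
    show "((\<lambda>s. g1 G 0 (\<tau> n s)) has_integral (d - c) * fst (average (\<phi> n) J)) {c..d}"
      using has_integral_linear[OF h bounded_linear_fst] by (simp add: o_def \<phi>_def g1_def)
    show "((\<lambda>s. g2 G 0 (\<tau> n s)) has_integral (d - c) * snd (average (\<phi> n) J)) {c..d}"
      using has_integral_linear[OF h bounded_linear_snd] by (simp add: o_def \<phi>_def g2_def)
  qed
  have avg_I: "average (\<phi> n) I = z" for n
    using has_integral_unique[OF avg(1)[OF I(2,3,1)] *(4)]
      has_integral_unique[OF avg(2)[OF I(2,3,1)] *(5)] I(1) by (simp add: prod_eq_iff)
  have avg_J: "average (\<phi> n) J \<in> Omega G \<epsilon>" if sub: "proper_interval J" "J \<subseteq> I" for J n
  proof -
    obtain c d where J: "c < d" "{c<..<d} \<subseteq> J" "J \<subseteq> {c..d}"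
      using obtain_interval_bounds[OF sub(1)] by blast
    have "{c<..<d} \<subseteq> {a..b}" using J(2) sub(2) I(3) by blast
    then have "a \<le> c \<and> d \<le> b" using J(1) by (simp add: greaterThanLessThan_subseteq_atLeastAtMost_iff)
    then obtain r where "segment_point r (fst (average (\<phi> n) J)) (snd (average (\<phi> n) J))"
      using *(3)[of n] avg[OF J(2,3,1), of n] J(1) unfolding averages_in_segments_def by blast
    from segment_point_in_Omega[OF this] show ?thesis by simp
  qed
  have test: "test_function (Omega G \<epsilon>) (fixed_boundary G) I z (\<phi> n)" for n
    unfolding test_function_def A_class_def
    using avg_I avg_J int_\<phi> measure_interval(1)[OF I(2,3)] I(1)
    by (auto simp: fixed_boundary_def \<phi>_def)
  have "average (boundary_fun G f \<circ> \<phi> n) I = L n / (b - a)" for n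
  proof -
    have "((\<lambda>s. f (\<tau> n s)) has_integral (b - a) *\<^sub>R average (\<lambda>s. f (\<tau> n s)) I) {a..b}"
      by (rule average_has_integral[OF I(2,3,1) int_f])
    from has_integral_unique[OF this *(6)] show ?thesis using I(1) by (simp add: bf field_simps)
  qed
  moreover have "(\<lambda>n. L n / (b - a)) \<longlonglongrightarrow> (b - a) * B z / (b - a)"
    by (intro tendsto_divide lim tendsto_const) (use I(1) in simp)
  ultimately have "(\<lambda>n. average (boundary_fun G f \<circ> \<phi> n) I) \<longlonglongrightarrow> B z" using I(1) by simp
  then have "optimizing_sequence (Omega G \<epsilon>) (fixed_boundary G) (boundary_fun G f) I B z \<phi>"
    unfolding optimizing_sequence_def using test int_f by (simp add: bf)
  moreover have "nonincreasing_on G I (\<phi> n)" for n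
    unfolding nonincreasing_on_def monotone_on_def boundary_le_def \<phi>_def
    using antimonoD[OF *(1)] by blast
  moreover have "boundary_le G (G 0 v) (\<phi> n s)" for n s
    using *(2)[of n s] t(1) unfolding boundary_le_def \<phi>_def by fastforce
  ultimately show ?thesis by blast
qed

end

theorem theorem5p4p21:
  fixes \<epsilon>max :: ereal and G :: "real \<Rightarrow> real \<Rightarrow> real \<times> real" and \<epsilon> v :: real
    and f :: "real \<Rightarrow> real" and B :: "real \<times> real \<Rightarrow> real" and I :: "real set"
  assumes "admissible_family \<epsilon>max G"
    and "0 < \<epsilon>" and "ereal \<epsilon> < \<epsilon>max"
    and "regular_fun G f"
    and "standard_candidate G \<epsilon> f v B"
    and "proper_interval I"
  shows "\<forall>x\<in>Omega_L G \<epsilon> v. \<exists>\<phi> :: nat \<Rightarrow> real \<Rightarrow> real \<times> real.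
    optimizing_sequence (Omega G \<epsilon>) (fixed_boundary G) (boundary_fun G f) I B x \<phi> \<and>
    (\<forall>n. nonincreasing_on G I (\<phi> n)) \<and>
    (\<forall>n. \<forall>s\<in>I. boundary_le G (G 0 v) (\<phi> n s))"
proof -
  interpret admissible_candidate \<epsilon>max G \<epsilon> f v B
    by unfold_locales (use assms in auto)
  show ?thesis using exists_optimizing_sequence[OF assms(6)] by blast
qed

end
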